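(* For every $A\in 2^{\mathbb{N}}$, $A$ strongly relativizes $\Delta^0_1$ at $\mathbb{N}$ if and only if $A$ is computably dominated. In particular, there are continuum-many reals which strongly relativize $\Delta^0_1$ at $\mathbb{N}$.
   Context: Elements of $2^{\mathbb{N}}$ are identified with subsets of $\mathbb{N}$ and are also regarded as elements of $\mathbb{N}^{\mathbb{N}}$ (reals). A set $Q\subseteq\mathbb{N}^{\mathbb{N}}\times\mathbb{N}$ is $\Sigma^0_1$ if it is a union of a c.e. family of basic open sets $[\sigma]\times\{n\}$, where $[\sigma]=\{h\in\mathbb{N}^{\mathbb{N}}:\sigma\sqsubset h\}$ for a finite sequence $\sigma$; it is $\Delta^0_1$ if both it and its complement are $\Sigma^0_1$. For $f\in\mathbb{N}^{\mathbb{N}}$, a set $B\subseteq\mathbb{N}$ is $\Delta^0_1(f)$ if both $B$ and its complement are $f$-sections $Q_f=\{n:Q(f,n)\}$ of $\Sigma^0_1$ sets $Q\subseteq\mathbb{N}^{\mathbb{N}}\times\mathbb{N}$ (equivalently, $B\le_T f$). A real $f\in\mathbb{N}^{\mathbb{N}}$ strongly relativizes $\Delta^0_1$ at $\mathbb{N}$ if every $\Delta^0_1(f)$ set $B\subseteq\mathbb{N}$ equals $Q_f$ for some $\Delta^0_1$ set $Q\subseteq\mathbb{N}^{\mathbb{N}}\times\mathbb{N}$. A real $f$ is computably dominated if for every $g\in\mathbb{N}^{\mathbb{N}}$ with $g\le_T f$ there is a computable $h\in\mathbb{N}^{\mathbb{N}}$ with $g(n)\le h(n)$ for all $n$. *)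

theory Defs
  imports
    Complex_Main
    "HOL-Library.Nat_Bijection"
    "HOL-Library.Indicator_Function"
    "HOL-Library.Equipollence"
begin

text \<open>
  Kleene's partial recursive functions, relative to a set \<open>F\<close> of total functions. All functions are
  unary; several arguments are passed through the pairing function \<open>prod_encode\<close>, whose
  two projections are among the initial functions.
\<close>

definition prim_recurse :: "(nat \<rightharpoonup> nat) \<Rightarrow> (nat \<rightharpoonup> nat) \<Rightarrow> (nat \<rightharpoonup> nat)" where
  "prim_recurse p q n =
     (case prod_decode n of (a, k) \<Rightarrow>
        rec_nat (p a) (\<lambda>j r. Option.bind r (\<lambda>i. q (prod_encode (a, prod_encode (j, i))))) k)"

text \<open>Unbounded search diverges if some value before the first zero is undefined.\<close>

definition minimize :: "(nat \<rightharpoonup> nat) \<Rightarrow> (nat \<rightharpoonup> nat)" where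
  "minimize p a =
     (if \<exists>k. p (prod_encode (a, k)) = Some 0 \<and> (\<forall>j<k. \<exists>v. p (prod_encode (a, j)) = Some (Suc v))
      then Some (LEAST k. p (prod_encode (a, k)) = Some 0)
      else None)"

inductive partial_recursive_in :: "(nat \<Rightarrow> nat) set \<Rightarrow> (nat \<rightharpoonup> nat) \<Rightarrow> bool"
  for F :: "(nat \<Rightarrow> nat) set" where
  base: "f \<in> F \<Longrightarrow> partial_recursive_in F (\<lambda>n. Some (f n))"
| zero: "partial_recursive_in F (\<lambda>n. Some 0)"
| succ: "partial_recursive_in F (\<lambda>n. Some (Suc n))"
| proj1: "partial_recursive_in F (\<lambda>n. Some (fst (prod_decode n)))"
| proj2: "partial_recursive_in F (\<lambda>n. Some (snd (prod_decode n)))"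
| pair: "partial_recursive_in F p \<Longrightarrow> partial_recursive_in F q \<Longrightarrow>
    partial_recursive_in F
      (\<lambda>n. Option.bind (p n) (\<lambda>x. Option.bind (q n) (\<lambda>y. Some (prod_encode (x, y)))))"
| comp: "partial_recursive_in F p \<Longrightarrow> partial_recursive_in F q \<Longrightarrow>
    partial_recursive_in F (\<lambda>n. Option.bind (q n) p)"
| prim_rec: "partial_recursive_in F p \<Longrightarrow> partial_recursive_in F q \<Longrightarrow>
    partial_recursive_in F (prim_recurse p q)"
| mu: "partial_recursive_in F p \<Longrightarrow> partial_recursive_in F (minimize p)"

definition computable :: "(nat \<Rightarrow> nat) \<Rightarrow> bool" where
  "computable h \<longleftrightarrow> partial_recursive_in {} (\<lambda>n. Some (h n))"

definition turing_le :: "(nat \<Rightarrow> nat) \<Rightarrow> (nat \<Rightarrow> nat) \<Rightarrow> bool"  (infix \<open>\<le>\<^sub>T\<close> 50) where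
  "g \<le>\<^sub>T f \<longleftrightarrow> partial_recursive_in {f} (\<lambda>n. Some (g n))"

definition ce :: "nat set \<Rightarrow> bool" where
  "ce W \<longleftrightarrow> (\<exists>p. partial_recursive_in {} p \<and> W = dom p)"

definition cylinder :: "nat list \<Rightarrow> (nat \<Rightarrow> nat) set" where
  "cylinder \<sigma> = {h. \<forall>i<length \<sigma>. h i = \<sigma> ! i}"

definition Sigma01 :: "((nat \<Rightarrow> nat) \<times> nat) set \<Rightarrow> bool" where
  "Sigma01 Q \<longleftrightarrow>
     (\<exists>S :: (nat list \<times> nat) set.
        ce ((\<lambda>(\<sigma>, n). prod_encode (list_encode \<sigma>, n)) ` S) \<and>
        Q = (\<Union>(\<sigma>, n)\<in>S. cylinder \<sigma> \<times> {n}))"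

definition Delta01 :: "((nat \<Rightarrow> nat) \<times> nat) set \<Rightarrow> bool" where
  "Delta01 Q \<longleftrightarrow> Sigma01 Q \<and> Sigma01 (- Q)"

definition slice :: "((nat \<Rightarrow> nat) \<times> nat) set \<Rightarrow> (nat \<Rightarrow> nat) \<Rightarrow> nat set" where
  "slice Q f = {n. (f, n) \<in> Q}"

definition Delta01_in :: "(nat \<Rightarrow> nat) \<Rightarrow> nat set \<Rightarrow> bool" where
  "Delta01_in f B \<longleftrightarrow>
     (\<exists>Q. Sigma01 Q \<and> B = slice Q f) \<and> (\<exists>Q. Sigma01 Q \<and> - B = slice Q f)"

definition strongly_relativizes_Delta01 :: "(nat \<Rightarrow> nat) \<Rightarrow> bool" where
  "strongly_relativizes_Delta01 f \<longleftrightarrow>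
     (\<forall>B. Delta01_in f B \<longrightarrow> (\<exists>Q. Delta01 Q \<and> B = slice Q f))"

definition computably_dominated :: "(nat \<Rightarrow> nat) \<Rightarrow> bool" where
  "computably_dominated f \<longleftrightarrow>
     (\<forall>g. g \<le>\<^sub>T f \<longrightarrow> (\<exists>h. computable h \<and> (\<forall>n. g n \<le> h n)))"

end

theory Submission
  imports Defs "HOL-Analysis.Abstract_Topology_2"
begin

text \<open>
  If \<open>f\<close> is computably dominated, the time at which one of the two enumerations of \<open>B\<close> and its complement
  answers is bounded by a computable function, and cutting the enumeration of \<open>B\<close> off at that bound
  gives a \<open>\<Delta>\<^sup>0\<^sub>1\<close> set; this works for every \<open>f\<close>, two-valued or not. Conversely, by compactness of Cantor
  space a \<open>\<Delta>\<^sup>0\<^sub>1\<close> set decides each \<open>n\<close> within computable time uniformly in the oracle, so a function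
  \<open>g \<le>\<^sub>T A\<close> that is not computably dominated leaves time to diagonalize against all \<open>\<Delta>\<^sup>0\<^sub>1\<close> sets.

  For the cardinality, start with a nonempty \<open>\<Pi>\<^sup>0\<^sub>1\<close> class all of whose nonempty \<open>\<Pi>\<^sup>0\<^sub>1\<close> subclasses have two
  members. Splitting repeatedly along a binary tree, and at level \<open>e\<close> making the \<open>e\<close>-th functional
  either divergent or total throughout the class, yields for each branch a computably dominated real.
\<close>

subsection \<open>Recursive functions and decidable predicates\<close>

definition pfst :: "nat \<Rightarrow> nat" where
  "pfst n = fst (prod_decode n)"

definition psnd :: "nat \<Rightarrow> nat" where
  "psnd n = snd (prod_decode n)"

lemma pfst_encode [simp]: "pfst (prod_encode (a, b)) = a"
  and psnd_encode [simp]: "psnd (prod_encode (a, b)) = b"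
  by (simp_all add: pfst_def psnd_def)

lemma prod_encode_pfst_psnd [simp]: "prod_encode (pfst n, psnd n) = n"
  by (simp add: pfst_def psnd_def)

lemma pfst_le: "pfst n \<le> n"
  using le_prod_encode_1[of "pfst n" "psnd n"] by simp

lemma psnd_le: "psnd n \<le> n"
  using le_prod_encode_2[of "psnd n" "pfst n"] by simp

lemma pfst_0 [simp]: "pfst 0 = 0" and psnd_0 [simp]: "psnd 0 = 0"
  using pfst_le[of 0] psnd_le[of 0] by simp_all

definition rec_in :: "(nat \<Rightarrow> nat) set \<Rightarrow> (nat \<Rightarrow> nat) \<Rightarrow> bool" where
  "rec_in F g \<longleftrightarrow> partial_recursive_in F (\<lambda>n. Some (g n))"

definition dec_in :: "(nat \<Rightarrow> nat) set \<Rightarrow> (nat \<Rightarrow> bool) \<Rightarrow> bool" where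
  "dec_in F P \<longleftrightarrow> rec_in F (\<lambda>n. if P n then 1 else 0)"

lemma computable_iff_rec_in: "computable h \<longleftrightarrow> rec_in {} h"
  by (simp add: computable_def rec_in_def)

lemma turing_le_iff_rec_in: "g \<le>\<^sub>T f \<longleftrightarrow> rec_in {f} g"
  by (simp add: turing_le_def rec_in_def)

text \<open>The rules collected here have their arguments already composed with recursive functions,
  so \<open>intro\<close> proves recursiveness by following the syntax of a term.\<close>

named_theorems rec_intros

lemma rec_id [rec_intros]: "rec_in F (\<lambda>n. n)"
  using partial_recursive_in.pair[OF partial_recursive_in.proj1 partial_recursive_in.proj2, of F]
  by (simp add: rec_in_def)

lemma rec_comp:
  assumes "rec_in F p" "rec_in F q"
  shows "rec_in F (\<lambda>n. p (q n))"
  using partial_recursive_in.comp[OF assms[unfolded rec_in_def]] by (simp add: rec_in_def)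

lemma rec_Suc [rec_intros]: "rec_in F a \<Longrightarrow> rec_in F (\<lambda>n. Suc (a n))"
  by (rule rec_comp[of _ Suc]) (simp add: rec_in_def partial_recursive_in.succ)

lemma rec_const [rec_intros]: "rec_in F (\<lambda>n. c)"
proof (induction c)
  case 0
  show ?case by (simp add: rec_in_def partial_recursive_in.zero)
qed (rule rec_Suc)

lemma rec_oracle: "rec_in {f} a \<Longrightarrow> rec_in {f} (\<lambda>n. f (a n))"
  by (rule rec_comp[of _ f]) (simp add: rec_in_def partial_recursive_in.base)

lemma rec_pair [rec_intros]:
  assumes "rec_in F a" "rec_in F b"
  shows "rec_in F (\<lambda>n. prod_encode (a n, b n))"
  using partial_recursive_in.pair[OF assms[unfolded rec_in_def]] by (simp add: rec_in_def)

lemma rec_pfst [rec_intros]: "rec_in F a \<Longrightarrow> rec_in F (\<lambda>n. pfst (a n))"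
  by (rule rec_comp[of _ pfst]) (simp add: rec_in_def pfst_def partial_recursive_in.proj1)

lemma rec_psnd [rec_intros]: "rec_in F a \<Longrightarrow> rec_in F (\<lambda>n. psnd (a n))"
  by (rule rec_comp[of _ psnd]) (simp add: rec_in_def psnd_def partial_recursive_in.proj2)

text \<open>Currying: the premise is the shape in which a bound variable is passed on, paired with
  the parameter of the enclosing term.\<close>

lemma rec_comp2:
  assumes "rec_in F (\<lambda>z. p (pfst z) (psnd z))" "rec_in F a" "rec_in F b"
  shows "rec_in F (\<lambda>n. p (a n) (b n))"
  using rec_comp[OF assms(1) rec_pair[OF assms(2,3)]] by simp

lemma rec_comp3:
  assumes "rec_in F (\<lambda>z. p (pfst z) (pfst (psnd z)) (psnd (psnd z)))"
    "rec_in F a" "rec_in F b" "rec_in F c"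
  shows "rec_in F (\<lambda>n. p (a n) (b n) (c n))"
  using rec_comp[OF assms(1) rec_pair[OF assms(2) rec_pair[OF assms(3,4)]]] by simp

text \<open>\<open>prim_recurse\<close> acts on pairs (parameter, counter). For total data
  \<open>Option.bind\<close> never fails, so the recursion is \<open>rec_nat\<close> under
  \<open>Some\<close>; feeding it the pair of \<open>n\<close> and \<open>k n\<close> lets the step
  function depend on \<open>n\<close>.\<close>

lemma rec_rec_nat [rec_intros]:
  assumes a: "rec_in F a"
    and s: "rec_in F (\<lambda>z. s (pfst z) (pfst (psnd z)) (psnd (psnd z)))"
    and k: "rec_in F k"
  shows "rec_in F (\<lambda>n. rec_nat (a n) (s n) (k n))"
proof -
  have "partial_recursive_in F
      (prim_recurse (\<lambda>n. Some (a n)) (\<lambda>z. Some (s (pfst z) (pfst (psnd z)) (psnd (psnd z)))))"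
    using a s unfolding rec_in_def by (rule partial_recursive_in.prim_rec)
  moreover have "prim_recurse (\<lambda>n. Some (a n)) (\<lambda>z. Some (s (pfst z) (pfst (psnd z)) (psnd (psnd z))))
      = (\<lambda>z. Some (rec_nat (a (pfst z)) (s (pfst z)) (psnd z)))"
  proof
    fix z
    have "rec_nat (Some (a u)) (\<lambda>j r. Option.bind r (\<lambda>i. Some (s u j i))) m
        = Some (rec_nat (a u) (s u) m)" for u m
      by (induction m) auto
    then show "prim_recurse (\<lambda>n. Some (a n)) (\<lambda>z. Some (s (pfst z) (pfst (psnd z)) (psnd (psnd z)))) z
        = Some (rec_nat (a (pfst z)) (s (pfst z)) (psnd z))"
      by (simp add: prim_recurse_def pfst_def[of z] psnd_def[of z] case_prod_beta)
  qed
  ultimately have "rec_in F (\<lambda>z. rec_nat (a (pfst z)) (s (pfst z)) (psnd z))"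
    by (simp add: rec_in_def)
  from rec_comp2[OF this rec_id k] show ?thesis .
qed

lemma rec_add [rec_intros]:
  assumes "rec_in F a" "rec_in F b"
  shows "rec_in F (\<lambda>n. a n + b n)"
proof -
  have "rec_in F (\<lambda>n. rec_nat (a n) (\<lambda>j r. Suc r) (b n))"
    by (intro rec_intros assms)
  moreover have "rec_nat x (\<lambda>j r. Suc r) y = x + y" for x y :: nat
    by (induction y) auto
  ultimately show ?thesis by simp
qed

lemma rec_mult [rec_intros]:
  assumes "rec_in F a" "rec_in F b"
  shows "rec_in F (\<lambda>n. a n * b n)"
proof -
  have "rec_in F (\<lambda>n. rec_nat 0 (\<lambda>j r. r + a n) (b n))"
    by (intro rec_intros rec_comp[OF assms(1)] assms(2))
  moreover have "rec_nat 0 (\<lambda>j r. r + x) y = x * y" for x y :: nat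
    by (induction y) auto
  ultimately show ?thesis by simp
qed

lemma rec_power [rec_intros]:
  assumes "rec_in F a" "rec_in F b"
  shows "rec_in F (\<lambda>n. a n ^ b n)"
proof -
  have "rec_in F (\<lambda>n. rec_nat 1 (\<lambda>j r. r * a n) (b n))"
    by (intro rec_intros rec_comp[OF assms(1)] assms(2))
  moreover have "rec_nat 1 (\<lambda>j r. r * x) y = x ^ y" for x y :: nat
    by (induction y) auto
  ultimately show ?thesis by simp
qed

lemma rec_pred:
  assumes "rec_in F a"
  shows "rec_in F (\<lambda>n. a n - 1)"
proof -
  have "rec_in F (\<lambda>n. rec_nat 0 (\<lambda>j r. j) (a n))"
    by (intro rec_intros assms)
  moreover have "rec_nat 0 (\<lambda>j r. j) y = y - 1" for y :: nat
    by (induction y) auto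
  ultimately show ?thesis by simp
qed

lemma rec_diff [rec_intros]:
  assumes "rec_in F a" "rec_in F b"
  shows "rec_in F (\<lambda>n. a n - b n)"
proof -
  have "rec_in F (\<lambda>n. rec_nat (a n) (\<lambda>j r. r - 1) (b n))"
    by (intro rec_rec_nat rec_pred rec_intros assms)
  moreover have "rec_nat x (\<lambda>j r. r - 1) y = x - y" for x y :: nat
    by (induction y) auto
  ultimately show ?thesis by simp
qed

lemma rec_if [rec_intros]:
  assumes "dec_in F P" "rec_in F a" "rec_in F b"
  shows "rec_in F (\<lambda>n. if P n then a n else b n)"
proof -
  have "rec_in F (\<lambda>n. rec_nat (b n) (\<lambda>_ _. a n) (if P n then 1 else 0))"
    by (intro rec_rec_nat rec_comp[OF assms(2)] rec_intros assms(3) assms(1)[unfolded dec_in_def])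
  moreover have "rec_nat (b n) (\<lambda>_ _. a n) (if P n then 1 else 0) = (if P n then a n else b n)" for n
    by simp
  ultimately show ?thesis by simp
qed

lemma dec_comp2:
  "dec_in F (\<lambda>z. P (pfst z) (psnd z)) \<Longrightarrow> rec_in F a \<Longrightarrow> rec_in F b \<Longrightarrow> dec_in F (\<lambda>n. P (a n) (b n))"
  unfolding dec_in_def by (rule rec_comp2)

lemma dec_comp3:
  "dec_in F (\<lambda>z. P (pfst z) (pfst (psnd z)) (psnd (psnd z))) \<Longrightarrow>
   rec_in F a \<Longrightarrow> rec_in F b \<Longrightarrow> rec_in F c \<Longrightarrow> dec_in F (\<lambda>n. P (a n) (b n) (c n))"
  unfolding dec_in_def by (rule rec_comp3)

lemma dec_le [rec_intros]:
  assumes "rec_in F a" "rec_in F b"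
  shows "dec_in F (\<lambda>n. a n \<le> b n)"
proof -
  have "rec_in F (\<lambda>n. 1 - (a n - b n))"
    by (intro rec_intros assms)
  moreover have "1 - (x - y) = (if x \<le> y then 1 else 0)" for x y :: nat
    by auto
  ultimately show ?thesis by (simp add: dec_in_def)
qed

lemma dec_const [rec_intros]: "dec_in F (\<lambda>n. c)"
  by (auto simp: dec_in_def intro: rec_const)

lemma dec_if:
  assumes "dec_in F P" "dec_in F Q" "dec_in F R"
  shows "dec_in F (\<lambda>n. if P n then Q n else R n)"
proof -
  have "rec_in F (\<lambda>n. if P n then if Q n then 1 else 0 else if R n then 1 else 0)"
    by (intro rec_if assms rec_const)
  then show ?thesis
    unfolding dec_in_def by (rule back_subst[of "rec_in F"]) auto
qed

lemma dec_not [rec_intros]: "dec_in F P \<Longrightarrow> dec_in F (\<lambda>n. \<not> P n)"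
  using dec_if[of F P "\<lambda>_. False" "\<lambda>_. True"] by (simp add: dec_const if_bool_eq_disj)

lemma dec_conj [rec_intros]: "dec_in F P \<Longrightarrow> dec_in F Q \<Longrightarrow> dec_in F (\<lambda>n. P n \<and> Q n)"
  using dec_if[of F P Q "\<lambda>_. False"] by (simp add: dec_const if_bool_eq_disj)

lemma dec_disj [rec_intros]: "dec_in F P \<Longrightarrow> dec_in F Q \<Longrightarrow> dec_in F (\<lambda>n. P n \<or> Q n)"
  using dec_not[OF dec_conj[OF dec_not[of F P] dec_not[of F Q]]] by simp

lemma dec_less [rec_intros]: "rec_in F a \<Longrightarrow> rec_in F b \<Longrightarrow> dec_in F (\<lambda>n. a n < b n)"
  using dec_not[OF dec_le[of F b a]] by (simp add: not_le)

lemma dec_eq [rec_intros]: "rec_in F a \<Longrightarrow> rec_in F b \<Longrightarrow> dec_in F (\<lambda>n. a n = b n)"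
  using dec_conj[OF dec_le[of F a b] dec_le[of F b a]] by (simp add: eq_iff)

section \<open>Bounded quantifiers and unbounded search\<close>

lemma dec_bex [rec_intros]:
  assumes P: "dec_in F (\<lambda>z. P (pfst z) (psnd z))" and b: "rec_in F b"
  shows "dec_in F (\<lambda>n. \<exists>i<b n. P n i)"
proof -
  have "rec_in F (\<lambda>n. rec_nat 0 (\<lambda>i r. if P n i then 1 else r) (b n))"
    by (intro rec_rec_nat rec_if dec_comp2[OF P] rec_intros b)
  moreover have "rec_nat 0 (\<lambda>i r. if P n i then 1 else r) m = (if \<exists>i<m. P n i then 1 else (0::nat))" for n m
    by (induction m) (auto simp: less_Suc_eq)
  ultimately show ?thesis by (simp add: dec_in_def)
qed

lemma dec_ball [rec_intros]:
  assumes "dec_in F (\<lambda>z. P (pfst z) (psnd z))" and "rec_in F b"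
  shows "dec_in F (\<lambda>n. \<forall>i<b n. P n i)"
  using dec_not[OF dec_bex[OF dec_not[OF assms(1)] assms(2)]] by simp

lemma dec_bex_le [rec_intros]:
  assumes "dec_in F (\<lambda>z. P (pfst z) (psnd z))" and "rec_in F b"
  shows "dec_in F (\<lambda>n. \<exists>i\<le>b n. P n i)"
  using dec_bex[OF assms(1) rec_Suc[OF assms(2)]] by (simp add: less_Suc_eq_le)

text \<open>The characteristic function is total, so no search gets stuck before the least
  witness.\<close>

lemma search_in:
  assumes "dec_in F (\<lambda>z. P (pfst z) (psnd z))"
  shows "partial_recursive_in F (\<lambda>n. if \<exists>i. P n i then Some (LEAST i. P n i) else None)"
proof -
  have "rec_in F (\<lambda>z. if P (pfst z) (psnd z) then 0 else 1)"
    by (intro rec_if rec_intros assms)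
  then have "partial_recursive_in F (minimize (\<lambda>z. Some (if P (pfst z) (psnd z) then 0 else 1)))"
    unfolding rec_in_def by (rule partial_recursive_in.mu)
  moreover have "minimize (\<lambda>z. Some (if P (pfst z) (psnd z) then 0 else 1))
      = (\<lambda>n. if \<exists>i. P n i then Some (LEAST i. P n i) else None)"
  proof
    fix n
    have "(\<exists>k. P n k \<and> (\<forall>j<k. \<not> P n j)) \<longleftrightarrow> (\<exists>i. P n i)"
      by (metis exists_least_iff)
    moreover have "(\<exists>v. (if P n j then 0 else 1) = Suc v) \<longleftrightarrow> \<not> P n j" for j
      by auto
    moreover have "(if P n j then 0 else 1) = (0::nat) \<longleftrightarrow> P n j" for j
      by simp
    ultimately show "minimize (\<lambda>z. Some (if P (pfst z) (psnd z) then 0 else 1)) n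
        = (if \<exists>i. P n i then Some (LEAST i. P n i) else None)"
      by (simp add: minimize_def)
  qed
  ultimately show ?thesis by simp
qed

lemma rec_Least:
  assumes "dec_in F (\<lambda>z. P (pfst z) (psnd z))" "\<And>n. \<exists>i. P n i"
  shows "rec_in F (\<lambda>n. LEAST i. P n i)"
  using search_in[OF assms(1)] assms(2) by (simp add: rec_in_def)

lemma rec_div2 [rec_intros]:
  assumes "rec_in F a"
  shows "rec_in F (\<lambda>n. a n div 2)"
proof -
  have "rec_in F (\<lambda>x. LEAST q. x < 2 * Suc q)"
    by (rule rec_Least) (intro rec_intros, presburger)
  moreover have "(LEAST q. x < 2 * Suc q) = x div 2" for x
    by (rule Least_equality) auto
  ultimately show ?thesis using rec_comp[OF _ assms, of "\<lambda>x. x div 2"] by simp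
qed

lemma dec_odd [rec_intros]:
  assumes "rec_in F a"
  shows "dec_in F (\<lambda>n. odd (a n))"
proof -
  have "dec_in F (\<lambda>n. \<not> a n = 2 * (a n div 2))"
    by (intro rec_intros assms)
  moreover have "\<not> x = 2 * (x div 2) \<longleftrightarrow> odd x" for x :: nat
    by presburger
  ultimately show ?thesis by simp
qed

text \<open>The binary expansion of \<open>k\<close>, continued by zeros. The numbers
  \<open>k < 2 ^ N\<close> thus represent all binary strings of length \<open>N\<close>.\<close>

definition bit_fun :: "nat \<Rightarrow> nat \<Rightarrow> nat" where
  "bit_fun k i = (if i \<in> set_decode k then 1 else 0)"

lemma rec_bit_fun [rec_intros]:
  assumes "rec_in F a" "rec_in F b"
  shows "rec_in F (\<lambda>n. bit_fun (a n) (b n))"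
proof -
  have "rec_in F (\<lambda>n. if odd (rec_nat (a n) (\<lambda>j r. r div 2) (b n)) then 1 else 0)"
    by (intro rec_intros assms)
  moreover have "i \<in> set_decode k \<longleftrightarrow> odd (rec_nat k (\<lambda>j r. r div 2) i)" for i k
  proof -
    have "rec_nat k (\<lambda>j r. r div 2) i = k div 2 ^ i"
      by (induction i) (simp_all add: div_mult2_eq[symmetric] mult.commute)
    then show ?thesis by (simp add: set_decode_def)
  qed
  ultimately show ?thesis by (simp add: bit_fun_def)
qed

section \<open>Coded lists\<close>

lemma list_encode_tl: "list_encode (tl xs) = psnd (list_encode xs - 1)"
  by (cases xs) auto

lemma list_encode_eq_0_iff: "list_encode xs = 0 \<longleftrightarrow> xs = []"
  by (cases xs) auto

lemma length_le_list_encode: "length xs \<le> list_encode xs"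
proof (induction xs)
  case (Cons x xs)
  then show ?case using le_prod_encode_2[of "list_encode xs" x] by simp
qed simp

lemma length_list_decode_le: "length (list_decode c) \<le> c"
  using length_le_list_encode[of "list_decode c"] by simp

text \<open>Strictness comes from the successor in the code of a nonempty list. The bound later
  turns searches among members of a coded list into bounded quantifiers.\<close>

lemma mem_less_list_encode: "x \<in> set xs \<Longrightarrow> x < list_encode xs"
proof (induction xs)
  case (Cons a xs)
  then show ?case
    using le_prod_encode_1[of a "list_encode xs"] le_prod_encode_2[of "list_encode xs" a] by fastforce
qed simp

text \<open>The default 0 makes \<open>nthd xs\<close> a total function, so it can stand in for an
  oracle extending \<open>xs\<close>.\<close>

definition nthd :: "nat list \<Rightarrow> nat \<Rightarrow> nat" where
  "nthd xs i = (if i < length xs then xs ! i else 0)"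

lemma rec_drop [rec_intros]:
  assumes "rec_in F a" "rec_in F b"
  shows "rec_in F (\<lambda>n. list_encode (drop (a n) (list_decode (b n))))"
proof -
  \<comment> \<open>A nonempty list is coded by the successor of the pair (head, code of tail), so
    each round takes the tail; the code 0 of the empty list stays 0.\<close>
  have "rec_in F (\<lambda>n. rec_nat (b n) (\<lambda>j r. psnd (r - 1)) (a n))"
    by (intro rec_intros assms)
  moreover have "rec_nat c (\<lambda>j r. psnd (r - 1)) i = list_encode (drop i (list_decode c))" for c i
  proof (induction i)
    case (Suc i)
    have "drop (Suc i) (list_decode c) = tl (drop i (list_decode c))"
      by (simp add: drop_Suc drop_tl)
    with Suc show ?case by (simp add: list_encode_tl)
  qed simp
  ultimately show ?thesis by simp
qed

lemma rec_length [rec_intros]: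
  assumes "rec_in F a"
  shows "rec_in F (\<lambda>n. length (list_decode (a n)))"
proof -
  have ex: "\<exists>i. list_encode (drop i (list_decode c)) = 0" for c
    by (rule exI[of _ "length (list_decode c)"]) simp
  have "rec_in F (\<lambda>c. LEAST i. list_encode (drop i (list_decode c)) = 0)"
    by (rule rec_Least) (intro rec_intros, rule ex)
  moreover have "(LEAST i. list_encode (drop i (list_decode c)) = 0) = length (list_decode c)" for c
    by (rule Least_equality) (auto simp: list_encode_eq_0_iff)
  ultimately show ?thesis using rec_comp[OF _ assms] by simp
qed

lemma rec_nthd [rec_intros]:
  assumes "rec_in F a" "rec_in F b"
  shows "rec_in F (\<lambda>n. nthd (list_decode (a n)) (b n))"
proof -
  have "rec_in F (\<lambda>n. pfst (list_encode (drop (b n) (list_decode (a n))) - 1))"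
    by (intro rec_intros assms)
  moreover have "pfst (list_encode (drop i xs) - 1) = nthd xs i" for i xs
    by (cases "i < length xs") (simp_all add: nthd_def flip: Cons_nth_drop_Suc)
  ultimately show ?thesis by simp
qed

lemma dec_mem [rec_intros]:
  assumes "rec_in F a" "rec_in F b"
  shows "dec_in F (\<lambda>n. a n \<in> set (list_decode (b n)))"
proof -
  have "dec_in F (\<lambda>n. \<exists>i<length (list_decode (b n)). nthd (list_decode (b n)) i = a n)"
    by (intro rec_intros rec_comp[OF assms(1)] rec_comp[OF assms(2)] assms)
  then show ?thesis by (simp add: in_set_conv_nth nthd_def cong: conj_cong)
qed

subsection \<open>A universal computation predicate\<close>

text \<open>The computations of all programs are given by derivations: lists of triples (program, input, output)
  in which each triple is justified by the later ones, the oracle being consulted through \<open>R\<close>.\<close>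

abbreviation code :: "nat \<Rightarrow> nat \<Rightarrow> nat \<Rightarrow> nat" where
  "code i a b \<equiv> prod_encode (i, prod_encode (a, b))"

abbreviation trip :: "nat \<Rightarrow> nat \<Rightarrow> nat \<Rightarrow> nat" where
  "trip e x y \<equiv> prod_encode (e, prod_encode (x, y))"

text \<open>The tag \<open>pfst e\<close> tells how program \<open>e\<close> is built: 0 to 3
  initial functions, 4 oracle, 5 pairing, 6 composition, 7 primitive recursion, 8 search.
  \<open>X\<close> holds the triples available as premises.\<close>

definition justified :: "(nat \<Rightarrow> nat \<Rightarrow> bool) \<Rightarrow> nat \<Rightarrow> nat \<Rightarrow> nat \<Rightarrow> nat set \<Rightarrow> bool" where
  "justified R e x y X \<longleftrightarrow>
     pfst e = 0 \<and> y = 0 \<or>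
     pfst e = 1 \<and> y = Suc x \<or>
     pfst e = 2 \<and> y = pfst x \<or>
     pfst e = 3 \<and> y = psnd x \<or>
     pfst e = 4 \<and> R x y \<or>
     pfst e = 5 \<and> trip (pfst (psnd e)) x (pfst y) \<in> X \<and> trip (psnd (psnd e)) x (psnd y) \<in> X \<or>
     pfst e = 6 \<and> (\<exists>i. trip (psnd (psnd e)) x i \<in> X \<and> trip (pfst (psnd e)) i y \<in> X) \<or>
     pfst e = 7 \<and> psnd x = 0 \<and> trip (pfst (psnd e)) (pfst x) y \<in> X \<or>
     pfst e = 7 \<and> psnd x > 0 \<and>
       (\<exists>i. trip e (prod_encode (pfst x, psnd x - 1)) i \<in> X \<and>
         trip (psnd (psnd e)) (prod_encode (pfst x, prod_encode (psnd x - 1, i))) y \<in> X) \<or>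
     pfst e = 8 \<and> trip (pfst (psnd e)) (prod_encode (x, y)) 0 \<in> X \<and>
       (\<forall>j<y. \<exists>v. trip (pfst (psnd e)) (prod_encode (x, j)) (Suc v) \<in> X)"

fun derivation :: "(nat \<Rightarrow> nat \<Rightarrow> bool) \<Rightarrow> nat list \<Rightarrow> bool" where
  "derivation R [] \<longleftrightarrow> True"
| "derivation R (t # L) \<longleftrightarrow>
     justified R (pfst t) (pfst (psnd t)) (psnd (psnd t)) (set L) \<and> derivation R L"

definition theorems :: "(nat \<Rightarrow> nat \<Rightarrow> bool) \<Rightarrow> nat set" where
  "theorems R = {t. \<exists>L. derivation R L \<and> t \<in> set L}"

text \<open>\<open>X\<close> occurs positively only, and the oracle is consulted at the single pair
  \<open>x\<close>, \<open>y\<close>. Comparing oracles at this pair alone is what the use principle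
  exploits.\<close>

lemma justified_mono:
  assumes "justified R e x y X" "X \<subseteq> Y" "R x y \<longrightarrow> R' x y"
  shows "justified R' e x y Y"
  using assms unfolding justified_def by (elim disjE) (simp_all, (blast | meson subsetD)+)

text \<open>Every clause but search needs at most two premises, and a search with value
  \<open>y\<close> needs \<open>y + 1\<close>.\<close>

lemma justified_finite:
  assumes "justified R e x y X"
  shows "\<exists>Y\<subseteq>X. finite Y \<and> justified R e x y Y"
proof -
  have mu: "trip (pfst (psnd e)) (prod_encode (x, y)) 0 \<in> X"
      "\<forall>j<y. \<exists>v. trip (pfst (psnd e)) (prod_encode (x, j)) (Suc v) \<in> X" if "pfst e = 8"
    using assms that by (simp_all add: justified_def)
  show ?thesis
  proof (cases "pfst e = 8")
    case True
    with mu obtain v where v: "\<forall>j<y. trip (pfst (psnd e)) (prod_encode (x, j)) (Suc (v j)) \<in> X"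
      by metis
    let ?Y = "insert (trip (pfst (psnd e)) (prod_encode (x, y)) 0)
      ((\<lambda>j. trip (pfst (psnd e)) (prod_encode (x, j)) (Suc (v j))) ` {..<y})"
    have "justified R e x y ?Y"
      using True by (auto simp: justified_def)
    moreover have "?Y \<subseteq> X" "finite ?Y" using mu(1)[OF True] v by auto
    ultimately show ?thesis by blast
  next
    case False
    consider "justified R e x y {}"
      | t u where "t \<in> X" "u \<in> X" "justified R e x y {t, u}"
      using assms False unfolding justified_def by (elim disjE) auto
    then show ?thesis
    proof cases
      case (2 t u)
      then show ?thesis by (intro exI[of _ "{t, u}"]) auto
    qed auto
  qed
qed

text \<open>Each witness is part of the output of a triple in the list, hence below the list's code
  \<open>M\<close>. With all quantifiers bounded, justification becomes decidable.\<close>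

lemma justified_bounded:
  fixes M :: nat
  defines "X \<equiv> set (list_decode M)"
  shows "justified R e x y (set (list_decode M)) \<longleftrightarrow>
     pfst e = 0 \<and> y = 0 \<or>
     pfst e = 1 \<and> y = Suc x \<or>
     pfst e = 2 \<and> y = pfst x \<or>
     pfst e = 3 \<and> y = psnd x \<or>
     pfst e = 4 \<and> R x y \<or>
     pfst e = 5 \<and> trip (pfst (psnd e)) x (pfst y) \<in> X \<and> trip (psnd (psnd e)) x (psnd y) \<in> X \<or>
     pfst e = 6 \<and> (\<exists>i<M. trip (psnd (psnd e)) x i \<in> X \<and> trip (pfst (psnd e)) i y \<in> X) \<or>
     pfst e = 7 \<and> psnd x = 0 \<and> trip (pfst (psnd e)) (pfst x) y \<in> X \<or>
     pfst e = 7 \<and> 0 < psnd x \<and>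
       (\<exists>i<M. trip e (prod_encode (pfst x, psnd x - 1)) i \<in> X \<and>
         trip (psnd (psnd e)) (prod_encode (pfst x, prod_encode (psnd x - 1, i))) y \<in> X) \<or>
     pfst e = 8 \<and> trip (pfst (psnd e)) (prod_encode (x, y)) 0 \<in> X \<and>
       (\<forall>j<y. \<exists>v<M. trip (pfst (psnd e)) (prod_encode (x, j)) (Suc v) \<in> X)"
proof -
  have M: "i < M" if "trip e x i \<in> X" for e x i
    using mem_less_list_encode[OF that[unfolded X_def]] le_prod_encode_2[of i x]
      le_prod_encode_2[of "prod_encode (x, i)" e] by simp
  then have "(\<exists>i. trip e x i \<in> X \<and> Q i) \<longleftrightarrow> (\<exists>i<M. trip e x i \<in> X \<and> Q i)" for e x Q
    by blast
  moreover have "(\<exists>v. trip e x (Suc v) \<in> X) \<longleftrightarrow> (\<exists>v<M. trip e x (Suc v) \<in> X)" for e x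
    using M Suc_lessD by blast
  ultimately show ?thesis
    unfolding X_def[symmetric] justified_def by simp
qed

lemma derivation_append: "derivation R L \<Longrightarrow> derivation R L' \<Longrightarrow> derivation R (L @ L')"
proof (induction L)
  case (Cons t L)
  then show ?case
    using justified_mono[of R "pfst t" "pfst (psnd t)" "psnd (psnd t)" "set L" "set (L @ L')" R] by simp
qed simp

lemma derivation_iff_nth:
  "derivation R L \<longleftrightarrow> (\<forall>i<length L. justified R (pfst (L ! i)) (pfst (psnd (L ! i)))
     (psnd (psnd (L ! i))) (set (drop (Suc i) L)))"
  by (induction L) (auto simp: All_less_Suc2)

lemma finite_theorems:
  assumes "finite Y" "Y \<subseteq> theorems R"
  shows "\<exists>L. derivation R L \<and> Y \<subseteq> set L"
  using assms
proof (induction Y)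
  case empty
  show ?case by (intro exI[of _ "[]"]) simp
next
  case (insert t Y)
  then obtain L where "derivation R L" "Y \<subseteq> set L" by auto
  moreover obtain L' where "derivation R L'" "t \<in> set L'"
    using insert.prems by (auto simp: theorems_def)
  ultimately show ?case by (intro exI[of _ "L @ L'"]) (auto simp: derivation_append)
qed

text \<open>The derivable triples form a fixed point: all entries of a derivation are derivable, and
  conversely the finitely many premises used have derivations that can be concatenated and extended
  by one entry.\<close>

lemma trip_in_theorems_iff: "trip e x y \<in> theorems R \<longleftrightarrow> justified R e x y (theorems R)"
proof
  have "derivation R L \<Longrightarrow> t \<in> set L \<Longrightarrow> set L \<subseteq> theorems R \<Longrightarrow>
      justified R (pfst t) (pfst (psnd t)) (psnd (psnd t)) (theorems R)" for t L
  proof (induction L)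
    case (Cons u L)
    then show ?case
      using justified_mono[of R "pfst u" "pfst (psnd u)" "psnd (psnd u)" "set L" "theorems R" R] by auto
  qed simp
  note step = this
  assume "trip e x y \<in> theorems R"
  then obtain L where L: "derivation R L" "trip e x y \<in> set L"
    unfolding theorems_def by blast
  then have "set L \<subseteq> theorems R" unfolding theorems_def by blast
  with step[OF L] show "justified R e x y (theorems R)" by simp
next
  assume "justified R e x y (theorems R)"
  then obtain Y where Y: "finite Y" "Y \<subseteq> theorems R" "justified R e x y Y"
    using justified_finite[of R e x y "theorems R"] by auto
  then obtain L where "derivation R L" "Y \<subseteq> set L"
    using finite_theorems[OF Y(1,2)] by auto
  then have "derivation R (trip e x y # L)"
    using justified_mono[OF Y(3), of "set L" R] by simp
  then show "trip e x y \<in> theorems R"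
    unfolding theorems_def by (intro CollectI exI[of _ "trip e x y # L"]) simp
qed

text \<open>Induction on the construction of \<open>p\<close>: unfolding the fixed point equation
  once at the new code reduces it to the codes of the parts. Primitive recursion also takes an inner
  induction on the counter.\<close>

lemma partial_recursive_in_code:
  assumes "partial_recursive_in F p" and R: "\<And>f x y. f \<in> F \<Longrightarrow> R x y \<longleftrightarrow> f x = y"
  shows "\<exists>e. \<forall>x y. p x = Some y \<longleftrightarrow> trip e x y \<in> theorems R"
  using assms(1)
proof induction
  case (base f)
  show ?case
    by (rule exI[of _ "code 4 0 0"], subst trip_in_theorems_iff) (simp add: justified_def R[OF base])
next
  case zero
  show ?case
    by (rule exI[of _ "code 0 0 0"], subst trip_in_theorems_iff) (auto simp: justified_def)
next
  case succ
  show ?case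
    by (rule exI[of _ "code 1 0 0"], subst trip_in_theorems_iff) (auto simp: justified_def)
next
  case proj1
  show ?case
    by (rule exI[of _ "code 2 0 0"], subst trip_in_theorems_iff)
      (auto simp: justified_def pfst_def[symmetric])
next
  case proj2
  show ?case
    by (rule exI[of _ "code 3 0 0"], subst trip_in_theorems_iff)
      (auto simp: justified_def psnd_def[symmetric])
next
  case (pair p q)
  then obtain a b where ab: "\<And>x y. p x = Some y \<longleftrightarrow> trip a x y \<in> theorems R"
      "\<And>x y. q x = Some y \<longleftrightarrow> trip b x y \<in> theorems R"
    by metis
  have "Option.bind (p x) (\<lambda>u. Option.bind (q x) (\<lambda>v. Some (prod_encode (u, v)))) = Some y \<longleftrightarrow>
      p x = Some (pfst y) \<and> q x = Some (psnd y)" for x y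
    by (auto simp: bind_eq_Some_conv)
  then show ?case
    by (intro exI[of _ "code 5 a b"], subst trip_in_theorems_iff) (simp add: justified_def ab)
next
  case (comp p q)
  then obtain a b where ab: "\<And>x y. p x = Some y \<longleftrightarrow> trip a x y \<in> theorems R"
      "\<And>x y. q x = Some y \<longleftrightarrow> trip b x y \<in> theorems R"
    by metis
  show ?case
    by (rule exI[of _ "code 6 a b"], subst trip_in_theorems_iff)
      (simp add: justified_def ab bind_eq_Some_conv)
next
  case (prim_rec p q)
  then obtain a b where ab: "\<And>x y. p x = Some y \<longleftrightarrow> trip a x y \<in> theorems R"
      "\<And>x y. q x = Some y \<longleftrightarrow> trip b x y \<in> theorems R"
    by metis
  let ?r = "\<lambda>u. rec_nat (p u) (\<lambda>j r. Option.bind r (\<lambda>i. q (prod_encode (u, prod_encode (j, i)))))"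
  have "?r u k = Some y \<longleftrightarrow> trip (code 7 a b) (prod_encode (u, k)) y \<in> theorems R" for u k y
  proof (induction k arbitrary: y)
    case 0
    show ?case by (subst trip_in_theorems_iff) (simp add: justified_def ab)
  next
    case (Suc k)
    show ?case
      by (subst trip_in_theorems_iff) (simp add: justified_def ab Suc bind_eq_Some_conv)
  qed
  then have "prim_recurse p q x = Some y \<longleftrightarrow> trip (code 7 a b) x y \<in> theorems R" for x y
    by (simp add: prim_recurse_def case_prod_beta flip: pfst_def psnd_def)
  then show ?case by blast
next
  case (mu p)
  then obtain a where a: "\<And>x y. p x = Some y \<longleftrightarrow> trip a x y \<in> theorems R"
    by metis
  have "minimize p x = Some y \<longleftrightarrow> p (prod_encode (x, y)) = Some 0 \<and>
      (\<forall>j<y. \<exists>v. p (prod_encode (x, j)) = Some (Suc v))" (is "_ \<longleftrightarrow> ?Z y") for x y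
  proof -
    have "(LEAST k. p (prod_encode (x, k)) = Some 0) = k" if "?Z k" for k
      using that by (intro Least_equality) (auto simp: not_less[symmetric])
    then show ?thesis by (auto simp: minimize_def)
  qed
  then show ?case
    by (intro exI[of _ "code 8 a 0"], subst trip_in_theorems_iff) (simp add: justified_def a)
qed

section \<open>Finite oracles and the use principle\<close>

definition list_oracle :: "nat list \<Rightarrow> nat \<Rightarrow> nat \<Rightarrow> bool" where
  "list_oracle \<sigma> x y \<longleftrightarrow> x < length \<sigma> \<and> nthd \<sigma> x = y"

text \<open>All arguments are codes, of the finite oracle, of a triple and of a derivation, so that
  the relation can be decided.\<close>

definition derives :: "nat \<Rightarrow> nat \<Rightarrow> nat \<Rightarrow> bool" where
  "derives s t c \<longleftrightarrow> derivation (list_oracle (list_decode s)) (list_decode c) \<and> t \<in> set (list_decode c)"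

lemma dec_justified [rec_intros]:
  assumes s: "rec_in F s" and e: "rec_in F e" and x: "rec_in F x" and y: "rec_in F y" and c: "rec_in F c"
  shows "dec_in F (\<lambda>n. justified (list_oracle (list_decode (s n))) (e n) (x n) (y n)
    (set (list_decode (c n))))"
proof -
  show ?thesis
    unfolding justified_bounded list_oracle_def
    by (intro rec_intros rec_comp[OF s] rec_comp[OF e] rec_comp[OF x] rec_comp[OF y] rec_comp[OF c])
qed

lemma dec_derives [rec_intros]:
  assumes "rec_in F s" "rec_in F t" "rec_in F c"
  shows "dec_in F (\<lambda>n. derives (s n) (t n) (c n))"
proof -
  let ?j = "\<lambda>s c i u. justified (list_oracle (list_decode s)) (pfst u) (pfst (psnd u)) (psnd (psnd u))
    (set (list_decode (list_encode (drop (Suc i) (list_decode c)))))"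
  have "dec_in F (\<lambda>n. (\<forall>i<length (list_decode (c n)). ?j (s n) (c n) i (nthd (list_decode (c n)) i)) \<and>
      t n \<in> set (list_decode (c n)))"
    by (intro rec_intros rec_comp[OF assms(1)] rec_comp[OF assms(2)] rec_comp[OF assms(3)])
  then show ?thesis
    by (simp add: derives_def derivation_iff_nth nthd_def cong: imp_cong)
qed

lemma cylinder_iff: "h \<in> cylinder \<sigma> \<longleftrightarrow> (\<forall>i<length \<sigma>. nthd \<sigma> i = h i)"
  by (auto simp: cylinder_def nthd_def)

text \<open>The use principle: a derivation consults its oracle at finitely many places only.\<close>

lemma theorems_graph_iff:
  "t \<in> theorems (\<lambda>x y. f x = y) \<longleftrightarrow> (\<exists>s c. f \<in> cylinder (list_decode s) \<and> derives s t c)"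
proof
  assume "t \<in> theorems (\<lambda>x y. f x = y)"
  then obtain L where L: "derivation (\<lambda>x y. f x = y) L" "t \<in> set L"
    by (auto simp: theorems_def)
  \<comment> \<open>This segment is long enough: a query is at most the triple containing it, which
    is below the code of \<open>L\<close>.\<close>
  define \<sigma> where "\<sigma> = map f [0..<list_encode L]"
  have "derivation (list_oracle \<sigma>) M" if "derivation (\<lambda>x y. f x = y) M" "set M \<subseteq> set L" for M
    using that
  proof (induction M)
    case (Cons u M)
    have "u < list_encode L" using Cons.prems(2) by (intro mem_less_list_encode) auto
    moreover have "pfst (psnd u) \<le> u" using pfst_le psnd_le order_trans by blast
    ultimately have "f (pfst (psnd u)) = psnd (psnd u) \<longrightarrow>
        list_oracle \<sigma> (pfst (psnd u)) (psnd (psnd u))"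
      by (simp add: list_oracle_def \<sigma>_def nthd_def)
    with Cons show ?case
      using justified_mono[of "\<lambda>x y. f x = y" "pfst u" "pfst (psnd u)" "psnd (psnd u)" "set M" "set M"
          "list_oracle \<sigma>"] by simp
  qed simp
  from this[OF L(1)] have "derives (list_encode \<sigma>) t (list_encode L)"
    using L(2) by (simp add: derives_def)
  moreover have "f \<in> cylinder (list_decode (list_encode \<sigma>))"
    by (simp add: cylinder_def \<sigma>_def)
  ultimately show "\<exists>s c. f \<in> cylinder (list_decode s) \<and> derives s t c" by blast
next
  assume "\<exists>s c. f \<in> cylinder (list_decode s) \<and> derives s t c"
  then obtain s c where *: "f \<in> cylinder (list_decode s)" "derives s t c" by blast
  have "derivation (list_oracle (list_decode s)) M \<Longrightarrow> derivation (\<lambda>x y. f x = y) M" for M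
  proof (induction M)
    case (Cons u M)
    have "list_oracle (list_decode s) (pfst (psnd u)) (psnd (psnd u)) \<longrightarrow>
        f (pfst (psnd u)) = psnd (psnd u)"
      using *(1) by (auto simp: list_oracle_def cylinder_iff)
    with Cons show ?case
      using justified_mono[of "list_oracle (list_decode s)" "pfst u" "pfst (psnd u)" "psnd (psnd u)"
          "set M" "set M" "\<lambda>x y. f x = y"] by simp
  qed simp
  with *(2) show "t \<in> theorems (\<lambda>x y. f x = y)"
    by (auto simp: theorems_def derives_def)
qed

text \<open>The oracle code 0 is the empty sequence, which answers no query.\<close>

lemma partial_recursive_code:
  assumes "partial_recursive_in {} p"
  shows "\<exists>e. \<forall>x y. p x = Some y \<longleftrightarrow> (\<exists>c. derives 0 (trip e x y) c)"
proof -
  obtain e where "\<forall>x y. p x = Some y \<longleftrightarrow> trip e x y \<in> theorems (list_oracle [])"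
    using partial_recursive_in_code[OF assms, of "list_oracle []"] by auto
  moreover have "t \<in> theorems (list_oracle []) \<longleftrightarrow> (\<exists>c. derives 0 t c)" for t
    by (auto simp: theorems_def derives_def) (metis list_encode_inverse)
  ultimately show ?thesis by blast
qed

lemma partial_recursive_in_use:
  assumes "partial_recursive_in {f} p"
  shows "\<exists>e. \<forall>x y. p x = Some y \<longleftrightarrow>
    (\<exists>s c. f \<in> cylinder (list_decode s) \<and> derives s (trip e x y) c)"
  using partial_recursive_in_code[OF assms, of "\<lambda>x y. f x = y"] by (simp add: theorems_graph_iff)

subsection \<open>Domination and strong relativization\<close>

text \<open>A stage \<open>s\<close> packs an output and a derivation into one number; the output
  itself is irrelevant to membership in the domain.\<close>

definition enum :: "nat \<Rightarrow> nat \<Rightarrow> nat \<Rightarrow> bool" where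
  "enum e x s \<longleftrightarrow> derives 0 (trip e x (pfst s)) (psnd s)"

lemma dec_enum [rec_intros]:
  assumes "rec_in F e" "rec_in F x" "rec_in F s"
  shows "dec_in F (\<lambda>n. enum (e n) (x n) (s n))"
  unfolding enum_def by (intro rec_intros assms)

lemma ce_enum:
  assumes "ce W"
  shows "\<exists>e. \<forall>x. x \<in> W \<longleftrightarrow> (\<exists>s. enum e x s)"
proof -
  obtain p e where W: "W = dom p"
    and e: "\<And>x y. p x = Some y \<longleftrightarrow> (\<exists>c. derives 0 (trip e x y) c)"
    using assms partial_recursive_code unfolding ce_def by metis
  have "x \<in> W \<longleftrightarrow> (\<exists>y c. derives 0 (trip e x y) c)" for x
    unfolding W dom_def using e by auto
  then have "x \<in> W \<longleftrightarrow> (\<exists>s. enum e x s)" for x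
    unfolding enum_def by (metis pfst_encode psnd_encode)
  then show ?thesis by blast
qed

section \<open>Open sets described by stages\<close>

abbreviation nbhd :: "nat \<Rightarrow> (nat \<Rightarrow> nat) set" where
  "nbhd s \<equiv> cylinder (list_decode (pfst s))"

text \<open>Here a stage packs a basic open set around \<open>f\<close> with a stage of its
  enumeration.\<close>

definition hit :: "nat \<Rightarrow> nat \<Rightarrow> (nat \<Rightarrow> nat) \<Rightarrow> nat \<Rightarrow> bool" where
  "hit e n f s \<longleftrightarrow> f \<in> nbhd s \<and> enum e (prod_encode (pfst s, n)) (psnd s)"

lemma cylinder_cong:
  assumes "\<And>i. i < c \<Longrightarrow> f i = g i"
  shows "f \<in> cylinder (list_decode c) \<longleftrightarrow> g \<in> cylinder (list_decode c)"
  using assms length_list_decode_le[of c] by (auto simp: cylinder_def)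

lemma nbhd_cong:
  assumes "\<And>i. i < s \<Longrightarrow> f i = g i"
  shows "f \<in> nbhd s \<longleftrightarrow> g \<in> nbhd s"
  using assms pfst_le[of s] by (intro cylinder_cong) auto

text \<open>A list is no longer than its code, and \<open>pfst s \<le> s\<close>; so a stage also
  bounds the part of the oracle it looks at.\<close>

lemma hit_cong:
  assumes "\<And>i. i < s \<Longrightarrow> f i = g i"
  shows "hit e n f s \<longleftrightarrow> hit e n g s"
  using nbhd_cong[OF assms] by (simp add: hit_def)

lemma dec_cylinder [rec_intros]:
  assumes h: "rec_in F (\<lambda>z. h (pfst z) (psnd z))" and c: "rec_in F c"
  shows "dec_in F (\<lambda>n. h n \<in> cylinder (list_decode (c n)))"
  unfolding cylinder_iff by (intro rec_intros h c rec_comp[OF c])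

lemma dec_hit [rec_intros]:
  assumes "rec_in F (\<lambda>z. h (pfst z) (psnd z))" "rec_in F e" "rec_in F m" "rec_in F s"
  shows "dec_in F (\<lambda>n. hit (e n) (m n) (h n) (s n))"
  unfolding hit_def by (intro rec_intros assms)

lemma Sigma01_iff_hit:
  assumes "Sigma01 Q"
  shows "\<exists>e. \<forall>f n. (f, n) \<in> Q \<longleftrightarrow> (\<exists>s. hit e n f s)"
proof -
  obtain S where S: "ce ((\<lambda>(\<sigma>, n). prod_encode (list_encode \<sigma>, n)) ` S)"
    and Q: "Q = (\<Union>(\<sigma>, n)\<in>S. cylinder \<sigma> \<times> {n})"
    using assms unfolding Sigma01_def by blast
  obtain e where e: "\<And>x. x \<in> (\<lambda>(\<sigma>, n). prod_encode (list_encode \<sigma>, n)) ` S \<longleftrightarrow> (\<exists>s. enum e x s)"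
    using ce_enum[OF S] by blast
  have S_iff: "(\<sigma>, n) \<in> S \<longleftrightarrow> (\<exists>s. enum e (prod_encode (list_encode \<sigma>, n)) s)" for \<sigma> n
    unfolding e[symmetric] by (force simp: image_iff list_encode_eq)
  have "(f, n) \<in> Q \<longleftrightarrow> (\<exists>s. hit e n f s)" for f n
  proof
    assume "(f, n) \<in> Q"
    then obtain \<sigma> s where "f \<in> cylinder \<sigma>" "enum e (prod_encode (list_encode \<sigma>, n)) s"
      using S_iff unfolding Q by blast
    then have "hit e n f (prod_encode (list_encode \<sigma>, s))" by (simp add: hit_def)
    then show "\<exists>s. hit e n f s" ..
  next
    assume "\<exists>s. hit e n f s"
    then obtain s where s: "f \<in> nbhd s" "enum e (prod_encode (pfst s, n)) (psnd s)"
      unfolding hit_def by blast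
    then have "(list_decode (pfst s), n) \<in> S" unfolding S_iff by auto
    with s(1) show "(f, n) \<in> Q" unfolding Q by blast
  qed
  then show ?thesis by blast
qed

text \<open>Converse of \<open>Sigma01_iff_hit\<close>: searching for \<open>s\<close> is a partial
  recursive function whose domain is the required c.e. family.\<close>

lemma Sigma01_search:
  assumes "dec_in {} (\<lambda>z. P (pfst z) (pfst (psnd z)) (psnd (psnd z)))"
  shows "Sigma01 {(f, n). \<exists>\<sigma> s. f \<in> cylinder (list_decode \<sigma>) \<and> P \<sigma> n s}"
proof -
  define S where "S = {(\<sigma>, n). \<exists>s. P (list_encode \<sigma>) n s}"
  have "dec_in {} (\<lambda>z. P (pfst (pfst z)) (psnd (pfst z)) (psnd z))"
    by (rule dec_comp3[OF assms]) (intro rec_intros)+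
  from search_in[OF this]
  have "ce {x. \<exists>s. P (pfst x) (psnd x) s}"
    unfolding ce_def by (intro exI conjI) (assumption, auto simp: dom_def)
  also have "{x. \<exists>s. P (pfst x) (psnd x) s} = (\<lambda>(\<sigma>, n). prod_encode (list_encode \<sigma>, n)) ` S"
  proof (intro set_eqI iffI)
    fix x assume "x \<in> {x. \<exists>s. P (pfst x) (psnd x) s}"
    then show "x \<in> (\<lambda>(\<sigma>, n). prod_encode (list_encode \<sigma>, n)) ` S"
      by (intro image_eqI[of _ _ "(list_decode (pfst x), psnd x)"]) (auto simp: S_def)
  qed (auto simp: S_def)
  finally have "ce ((\<lambda>(\<sigma>, n). prod_encode (list_encode \<sigma>, n)) ` S)" .
  moreover have "{(f, n). \<exists>\<sigma> s. f \<in> cylinder (list_decode \<sigma>) \<and> P \<sigma> n s} =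
      (\<Union>(\<sigma>, n)\<in>S. cylinder \<sigma> \<times> {n})"
    unfolding S_def by auto (metis list_decode_inverse, metis list_encode_inverse)
  ultimately show ?thesis unfolding Sigma01_def by blast
qed

text \<open>Any initial segment of \<open>f\<close> longer than \<open>h n\<close> decides
  \<open>C f n\<close>, whatever continues it; \<open>nthd\<close> continues it by zeros.\<close>

lemma Sigma01_bounded:
  assumes C: "dec_in {} (\<lambda>z. C (nthd (list_decode (pfst z))) (psnd z))"
    and h: "rec_in {} h"
    and cong: "\<And>f g n. (\<And>i. i \<le> h n \<Longrightarrow> f i = g i) \<Longrightarrow> C f n \<longleftrightarrow> C g n"
  shows "Sigma01 {(f, n). C f n}"
proof -
  have "Sigma01 {(f, n). \<exists>\<sigma> s::nat. f \<in> cylinder (list_decode \<sigma>) \<and>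
      h n < length (list_decode \<sigma>) \<and> C (nthd (list_decode \<sigma>)) n}"
    by (rule Sigma01_search[where P="\<lambda>\<sigma> n s. h n < length (list_decode \<sigma>) \<and> C (nthd (list_decode \<sigma>)) n"])
      (intro rec_intros rec_comp[OF h] dec_comp2[where P="\<lambda>a. C (nthd (list_decode a))", OF C])
  also have "{(f, n). \<exists>\<sigma> s::nat. f \<in> cylinder (list_decode \<sigma>) \<and>
      h n < length (list_decode \<sigma>) \<and> C (nthd (list_decode \<sigma>)) n} = {(f, n). C f n}"
  proof (intro set_eqI, clarify, intro iffI; clarsimp)
    fix f n \<sigma>
    assume "f \<in> cylinder (list_decode \<sigma>)" "h n < length (list_decode \<sigma>)" "C (nthd (list_decode \<sigma>)) n"
    moreover from this have "C (nthd (list_decode \<sigma>)) n \<longleftrightarrow> C f n"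
      by (intro cong) (auto simp: cylinder_iff)
    ultimately show "C f n" by simp
  next
    fix f n assume "C f n"
    let ?\<sigma> = "list_encode (map f [0..<Suc (h n)])"
    have "C (nthd (list_decode ?\<sigma>)) n \<longleftrightarrow> C f n"
      by (intro cong) (auto simp: nthd_def simp del: upt_Suc)
    with \<open>C f n\<close> show "\<exists>\<sigma>. f \<in> cylinder (list_decode \<sigma>) \<and> h n < length (list_decode \<sigma>) \<and>
        C (nthd (list_decode \<sigma>)) n"
      by (intro exI[of _ ?\<sigma>]) (auto simp: cylinder_def simp del: upt_Suc)
  qed
  finally show ?thesis .
qed

lemma Delta01_bounded_hit:
  assumes "rec_in {} h"
  shows "Delta01 {(f, n). \<exists>s\<le>h n. hit e n f s}"
proof -
  have cong: "(\<exists>s\<le>h n. hit e n f s) \<longleftrightarrow> (\<exists>s\<le>h n. hit e n g s)" if "\<And>i. i \<le> h n \<Longrightarrow> f i = g i" for f g n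
    using hit_cong[of _ f g] that by (metis order_trans less_imp_le)
  have dec: "dec_in {} (\<lambda>z. \<exists>s\<le>h (psnd z). hit e (psnd z) (nthd (list_decode (pfst z))) s)"
    by (intro rec_intros rec_comp[OF assms])
  have "Sigma01 {(f, n). \<exists>s\<le>h n. hit e n f s}"
    using dec assms cong by (rule Sigma01_bounded)
  moreover have "Sigma01 {(f, n). \<not> (\<exists>s\<le>h n. hit e n f s)}"
    using dec_not[OF dec] assms by (rule Sigma01_bounded) (use cong in blast)
  moreover have "- {(f, n). \<exists>s\<le>h n. hit e n f s} = {(f, n). \<not> (\<exists>s\<le>h n. hit e n f s)}"
    by auto
  ultimately show ?thesis by (simp add: Delta01_def)
qed

theorem computably_dominated_imp_strongly_relativizes:
  assumes "computably_dominated f"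
  shows "strongly_relativizes_Delta01 f"
  unfolding strongly_relativizes_Delta01_def
proof (intro allI impI)
  fix B assume "Delta01_in f B"
  then obtain Q R where QR: "Sigma01 Q" "B = slice Q f" "Sigma01 R" "- B = slice R f"
    unfolding Delta01_in_def by blast
  obtain d e where d: "\<And>f n. (f, n) \<in> Q \<longleftrightarrow> (\<exists>s. hit d n f s)"
    and e: "\<And>f n. (f, n) \<in> R \<longleftrightarrow> (\<exists>s. hit e n f s)"
    using Sigma01_iff_hit[OF QR(1)] Sigma01_iff_hit[OF QR(3)] by metis
  have B: "n \<in> B \<longleftrightarrow> (\<exists>s. hit d n f s)" "n \<notin> B \<longleftrightarrow> (\<exists>s. hit e n f s)" for n
    using QR(2,4) d e unfolding slice_def by blast+
  define g where "g n = (LEAST s. hit d n f s \<or> hit e n f s)" for n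
  have ex: "\<exists>s. hit d n f s \<or> hit e n f s" for n
    using B by blast
  have "rec_in {f} g"
    unfolding g_def by (rule rec_Least) (intro rec_intros rec_oracle, rule ex)
  then obtain h where h: "rec_in {} h" "\<And>n. g n \<le> h n"
    using assms unfolding computably_dominated_def turing_le_iff_rec_in computable_iff_rec_in by blast
  have g: "hit d n f (g n) \<or> hit e n f (g n)" for n
    unfolding g_def using ex by (rule LeastI_ex)
  \<comment> \<open>For \<open>n\<close> in \<open>B\<close> the enumeration \<open>e\<close> never
    answers, so the answer at stage \<open>g n\<close> comes from \<open>d\<close>.\<close>
  have "n \<in> B \<longleftrightarrow> (\<exists>s\<le>h n. hit d n f s)" for n
    using B g h(2) by blast
  then have "B = slice {(f, n). \<exists>s\<le>h n. hit d n f s} f"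
    by (auto simp: slice_def)
  with Delta01_bounded_hit[OF h(1)] show "\<exists>Q. Delta01 Q \<and> B = slice Q f" by blast
qed

section \<open>Compactness of Cantor space\<close>

definition cantor :: "(nat \<Rightarrow> nat) set" where
  "cantor = {f. \<forall>i. f i < 2}"

text \<open>Koenig's lemma: a string without a uniform bound has a one-bit extension without one.
  Following such extensions gives a path \<open>f\<close>, but a stage \<open>s\<close> with
  \<open>K f s\<close> serves all extensions of its first \<open>s\<close> bits.\<close>

lemma cantor_compact:
  fixes K :: "(nat \<Rightarrow> nat) \<Rightarrow> nat \<Rightarrow> bool"
  assumes cong: "\<And>f g s. (\<And>i. i < s \<Longrightarrow> f i = g i) \<Longrightarrow> K f s \<longleftrightarrow> K g s"
    and ex: "\<And>f. f \<in> cantor \<Longrightarrow> \<exists>s. K f s"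
  shows "\<exists>N. \<forall>f\<in>cantor. \<exists>s\<le>N. K f s"
proof (rule ccontr)
  define good where "good \<sigma> \<longleftrightarrow> (\<exists>N. \<forall>f\<in>cantor \<inter> cylinder \<sigma>. \<exists>s\<le>N. K f s)" for \<sigma>
  assume "\<not> ?thesis"
  then have nil: "\<not> good []" by (simp add: good_def cylinder_def)
  have step: "\<exists>b<2. \<not> good (\<sigma> @ [b])" if "\<not> good \<sigma>" for \<sigma>
  proof (rule ccontr)
    assume "\<not> ?thesis"
    then have "good (\<sigma> @ [0])" "good (\<sigma> @ [1])" by auto
    then obtain M N where MN: "\<And>f. f \<in> cantor \<inter> cylinder (\<sigma> @ [0]) \<Longrightarrow> \<exists>s\<le>M. K f s"
        "\<And>f. f \<in> cantor \<inter> cylinder (\<sigma> @ [1]) \<Longrightarrow> \<exists>s\<le>N. K f s"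
      unfolding good_def by blast
    have "\<exists>s\<le>max M N. K f s" if "f \<in> cantor \<inter> cylinder \<sigma>" for f
    proof -
      have "f (length \<sigma>) = 0 \<or> f (length \<sigma>) = 1" using that by (auto simp: cantor_def less_2_cases)
      then have "f \<in> cylinder (\<sigma> @ [0]) \<or> f \<in> cylinder (\<sigma> @ [1])"
        using that by (auto simp: cylinder_def nth_append less_Suc_eq)
      then show ?thesis using MN[of f] that by (auto simp: le_max_iff_disj)
    qed
    then have "good \<sigma>" unfolding good_def by (intro exI[of _ "max M N"]) simp
    with that show False ..
  qed
  then obtain nxt where nxt: "\<And>\<sigma>. \<not> good \<sigma> \<Longrightarrow> nxt \<sigma> < 2 \<and> \<not> good (\<sigma> @ [nxt \<sigma>])"
    by metis
  define path where "path n = rec_nat [] (\<lambda>_ \<sigma>. \<sigma> @ [nxt \<sigma>]) n" for n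
  define f where "f n = nxt (path n)" for n
  have path_Suc: "path (Suc n) = path n @ [f n]" for n by (simp add: path_def f_def)
  have bad: "\<not> good (path n)" for n
  proof (induction n)
    case 0
    show ?case using nil by (simp add: path_def)
  next
    case (Suc n)
    then show ?case using nxt[of "path n"] by (simp add: path_Suc f_def)
  qed
  have path: "path n = map f [0..<n]" for n
    by (induction n) (simp add: path_def, simp add: path_Suc)
  have "f \<in> cantor" using nxt[OF bad] by (simp add: cantor_def f_def)
  then obtain s where s: "K f s" using ex by blast
  have "K g s" if "g \<in> cylinder (map f [0..<s])" for g
    using s cong[of s f g] that by (auto simp: cylinder_def)
  then have "good (path s)" unfolding good_def path by blast
  with bad show False ..
qed

lemma cantor_approx:
  assumes "f \<in> cantor"
  shows "\<exists>k<2 ^ N. \<forall>i<N. bit_fun k i = f i"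
proof (intro exI conjI)
  let ?A = "{i. i < N \<and> f i = 1}"
  have "set_encode ?A \<le> (\<Sum>i\<in>{0..<N}. 2 ^ i)"
    unfolding set_encode_def by (intro sum_mono2) auto
  also have "\<dots> < 2 ^ N" by (simp add: sum_power2)
  finally show "set_encode ?A < 2 ^ N" .
  show "\<forall>i<N. bit_fun (set_encode ?A) i = f i"
    using assms by (auto simp: bit_fun_def cantor_def less_2_cases_iff)
qed

lemma bit_fun_cantor: "bit_fun k \<in> cantor"
  by (simp add: cantor_def bit_fun_def)

text \<open>Compactness yields a bound \<open>N\<close>, and testing one is a finite check over
  \<open>bit_fun k\<close> with \<open>k < 2 ^ N\<close>, because stages up to \<open>N\<close> see
  only \<open>N\<close> bits. Hence the least bound is computable.\<close>

lemma cantor_compact_effective: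
  fixes K :: "nat \<Rightarrow> (nat \<Rightarrow> nat) \<Rightarrow> nat \<Rightarrow> bool"
  assumes cong: "\<And>n f g s. (\<And>i. i < s \<Longrightarrow> f i = g i) \<Longrightarrow> K n f s \<longleftrightarrow> K n g s"
    and ex: "\<And>n f. f \<in> cantor \<Longrightarrow> \<exists>s. K n f s"
    and dec: "dec_in {} (\<lambda>z. K (pfst z) (bit_fun (pfst (psnd z))) (psnd (psnd z)))"
  shows "\<exists>h. rec_in {} h \<and> (\<forall>n. \<forall>f\<in>cantor. \<exists>s\<le>h n. K n f s)"
proof -
  define h where "h n = (LEAST N. \<forall>k<2 ^ N. \<exists>s\<le>N. K n (bit_fun k) s)" for n
  have h_ex: "\<exists>N. \<forall>k<2 ^ N. \<exists>s\<le>N. K n (bit_fun k) s" for n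
    using cantor_compact[of "K n", OF cong ex] bit_fun_cantor by blast
  have "rec_in {} h"
    unfolding h_def
    by (rule rec_Least)
      (intro rec_intros dec_comp3[where P="\<lambda>n k. K n (bit_fun k)", OF dec], rule h_ex)
  moreover have "\<exists>s\<le>h n. K n f s" if f: "f \<in> cantor" for n f
  proof -
    obtain k where k: "k < 2 ^ h n" "\<forall>i<h n. bit_fun k i = f i"
      using cantor_approx[OF f] by blast
    moreover have "\<forall>k<2 ^ h n. \<exists>s\<le>h n. K n (bit_fun k) s"
      unfolding h_def using h_ex by (rule LeastI_ex)
    ultimately obtain s where "s \<le> h n" "K n (bit_fun k) s" by blast
    then show ?thesis
      using cong[of s "bit_fun k" f n] k(2) by (intro exI[of _ s]) auto
  qed
  ultimately show ?thesis by blast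
qed

lemma Delta01_in_if_dec:
  assumes "dec_in {f} (\<lambda>n. n \<in> B)"
  shows "Delta01_in f B"
proof -
  obtain e where e: "\<And>x y. (Some (if x \<in> B then 1 else 0) = Some y) \<longleftrightarrow>
      (\<exists>s c. f \<in> cylinder (list_decode s) \<and> derives s (trip e x y) c)"
    using partial_recursive_in_use[OF assms[unfolded dec_in_def rec_in_def]] by blast
  \<comment> \<open>The pairs on which program \<open>e\<close> outputs \<open>v\<close>. The
    sections of \<open>Q 0\<close> and \<open>Q 1\<close> need to be complementary only at the given
    oracle.\<close>
  define Q where "Q v = {(f, n). \<exists>\<sigma> s. f \<in> cylinder (list_decode \<sigma>) \<and> derives \<sigma> (trip e n v) s}" for v
  have "Sigma01 (Q v)" for v
    unfolding Q_def by (rule Sigma01_search) (intro rec_intros)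
  moreover have "n \<in> B \<longleftrightarrow> (f, n) \<in> Q 1" "n \<notin> B \<longleftrightarrow> (f, n) \<in> Q 0" for n
    using e[of n 1] e[of n 0] by (simp_all add: Q_def split: if_splits)
  then have "B = slice (Q 1) f" "- B = slice (Q 0) f"
    by (auto simp: slice_def)
  ultimately show ?thesis unfolding Delta01_in_def by blast
qed

text \<open>The set \<open>B\<close> below reads \<open>m\<close> as a triple of indices \<open>d\<close>, \<open>e\<close> and a number \<open>n\<close>, runs the two
  enumerations at \<open>m\<close> for \<open>g n\<close> stages, and if one of them answers in time, disagrees at \<open>m\<close> with the
  set that \<open>d\<close> enumerates and \<open>e\<close> co-enumerates.\<close>

theorem strongly_relativizes_imp_computably_dominated:
  assumes f: "f \<in> cantor" and "strongly_relativizes_Delta01 f"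
  shows "computably_dominated f"
  unfolding computably_dominated_def turing_le_iff_rec_in computable_iff_rec_in
proof (intro allI impI)
  fix g assume g: "rec_in {f} g"
  define B where "B = {m. \<not> (\<exists>s\<le>g (psnd (psnd m)). hit (pfst m) m f s) \<and>
    (\<exists>s\<le>g (psnd (psnd m)). hit (pfst (psnd m)) m f s)}"
  have "dec_in {f} (\<lambda>m. m \<in> B)"
    unfolding B_def mem_Collect_eq by (intro rec_intros rec_oracle rec_comp[OF g])
  then obtain Q where Q: "Sigma01 Q" "Sigma01 (- Q)" "B = slice Q f"
    using assms(2) Delta01_in_if_dec unfolding strongly_relativizes_Delta01_def Delta01_def by blast
  obtain d e where d: "\<And>f n. (f, n) \<in> Q \<longleftrightarrow> (\<exists>s. hit d n f s)"
    and e: "\<And>f n. (f, n) \<in> - Q \<longleftrightarrow> (\<exists>s. hit e n f s)"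
    using Sigma01_iff_hit[OF Q(1)] Sigma01_iff_hit[OF Q(2)] by metis
  \<comment> \<open>Since \<open>d\<close> and \<open>e\<close> enumerate complementary sets, one of
    them answers on every oracle, not only on the given \<open>f\<close>; this is what compactness
    requires.\<close>
  have "\<exists>h. rec_in {} h \<and>
      (\<forall>n. \<forall>f\<in>cantor. \<exists>s\<le>h n. hit d (trip d e n) f s \<or> hit e (trip d e n) f s)"
  proof (rule cantor_compact_effective)
    show "\<exists>s. hit d (trip d e n) f s \<or> hit e (trip d e n) f s" for n f
      using d[of f "trip d e n"] e[of f "trip d e n"] by blast
    show "dec_in {} (\<lambda>z. hit d (trip d e (pfst z)) (bit_fun (pfst (psnd z))) (psnd (psnd z)) \<or>
        hit e (trip d e (pfst z)) (bit_fun (pfst (psnd z))) (psnd (psnd z)))"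
      by (intro rec_intros)
    show "hit d (trip d e n) f s \<or> hit e (trip d e n) f s \<longleftrightarrow>
        hit d (trip d e n) g s \<or> hit e (trip d e n) g s" if "\<And>i. i < s \<Longrightarrow> f i = g i" for n f g s
      using hit_cong[OF that] by simp
  qed
  then obtain h where h: "rec_in {} h"
    and hit: "\<And>n. \<exists>s\<le>h n. hit d (trip d e n) f s \<or> hit e (trip d e n) f s"
    using f by blast
  have "g n \<le> h n" for n
  proof (rule ccontr)
    assume "\<not> g n \<le> h n"
    then obtain s where "s \<le> g n" "hit d (trip d e n) f s \<or> hit e (trip d e n) f s"
      using hit[of n] by (meson le_trans nat_le_linear)
    moreover have "trip d e n \<in> B \<longleftrightarrow> \<not> (\<exists>s\<le>g n. hit d (trip d e n) f s) \<and>
        (\<exists>s\<le>g n. hit e (trip d e n) f s)"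
      by (simp add: B_def)
    moreover have "trip d e n \<in> B \<longleftrightarrow> (f, trip d e n) \<in> Q"
      using Q(3) by (simp add: slice_def)
    \<comment> \<open>If \<open>d\<close> answers, the triple is in \<open>Q\<close> but not in
      \<open>B\<close>; if \<open>e\<close> answers, \<open>d\<close> never does, and it is in
      \<open>B\<close> but not in \<open>Q\<close>.\<close>
    ultimately show False
      using d[of f "trip d e n"] e[of f "trip d e n"] by blast
  qed
  with h show "\<exists>h. rec_in {} h \<and> (\<forall>n. g n \<le> h n)" by blast
qed

subsection \<open>Continuum many computably dominated reals\<close>

text \<open>Indexed \<open>\<Pi>\<^sup>0\<^sub>1\<close> classes: \<open>e\<close> enumerates the
  basic open sets to be removed, listed under the fixed argument 0.\<close>

definition pi_class :: "nat \<Rightarrow> (nat \<Rightarrow> nat) set" where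
  "pi_class e = {f \<in> cantor. \<forall>s. \<not> hit e 0 f s}"

text \<open>The removed open sets of \<open>d\<close> and those given by \<open>P\<close> are merged
  into one enumeration.\<close>

lemma pi_class_avoid:
  assumes P: "dec_in {} (\<lambda>z. P (pfst z) (psnd z))"
  shows "\<exists>e. pi_class e = {f \<in> pi_class d. \<not> (\<exists>\<sigma> s. f \<in> cylinder (list_decode \<sigma>) \<and> P \<sigma> s)}"
proof -
  define Q where "Q = {(f, n :: nat). \<exists>\<sigma> s. f \<in> cylinder (list_decode \<sigma>) \<and>
      (enum d (prod_encode (\<sigma>, 0)) s \<or> P \<sigma> s)}"
  have "Sigma01 Q"
    unfolding Q_def by (rule Sigma01_search) (intro rec_intros dec_comp2[OF P])
  from Sigma01_iff_hit[OF this] obtain e where "\<And>f n. (f, n) \<in> Q \<longleftrightarrow> (\<exists>s. hit e n f s)"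
    by blast
  then have e: "(\<exists>s. hit e 0 f s) \<longleftrightarrow> (\<exists>\<sigma> s. f \<in> cylinder (list_decode \<sigma>) \<and>
      (enum d (prod_encode (\<sigma>, 0)) s \<or> P \<sigma> s))" for f
    unfolding Q_def by blast
  have d: "(\<exists>s. hit d 0 f s) \<longleftrightarrow>
      (\<exists>\<sigma> s. f \<in> cylinder (list_decode \<sigma>) \<and> enum d (prod_encode (\<sigma>, 0)) s)" for f
    unfolding hit_def by (metis pfst_encode psnd_encode)
  have "f \<in> pi_class e \<longleftrightarrow>
      f \<in> pi_class d \<and> \<not> (\<exists>\<sigma> s. f \<in> cylinder (list_decode \<sigma>) \<and> P \<sigma> s)" for f
    using e[of f] d[of f] unfolding pi_class_def by blast
  then show ?thesis by blast
qed

lemma pi_class_restrict: "\<exists>e. pi_class e = {f \<in> pi_class d. f j = v}"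
proof -
  have "dec_in {} (\<lambda>z. j < length (list_decode (pfst z)) \<and> nthd (list_decode (pfst z)) j \<noteq> v)"
    by (intro rec_intros)
  from pi_class_avoid[where P="\<lambda>\<sigma> (s::nat). j < length (list_decode \<sigma>) \<and> nthd (list_decode \<sigma>) j \<noteq> v",
      OF this, of d]
  obtain e where e: "pi_class e = {f \<in> pi_class d. \<not> (\<exists>\<sigma> s::nat. f \<in> cylinder (list_decode \<sigma>) \<and>
      j < length (list_decode \<sigma>) \<and> nthd (list_decode \<sigma>) j \<noteq> v)}"
    by blast
  have "(\<exists>\<sigma> s::nat. f \<in> cylinder (list_decode \<sigma>) \<and> j < length (list_decode \<sigma>) \<and>
      nthd (list_decode \<sigma>) j \<noteq> v) \<longleftrightarrow> f j \<noteq> v" for f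
  proof
    assume "f j \<noteq> v"
    then show "\<exists>\<sigma> s::nat. f \<in> cylinder (list_decode \<sigma>) \<and> j < length (list_decode \<sigma>) \<and>
        nthd (list_decode \<sigma>) j \<noteq> v"
      by (intro exI[of _ "list_encode (map f [0..<Suc j])"])
        (auto simp: cylinder_iff nthd_def simp del: upt_Suc)
  qed (auto simp: cylinder_iff)
  with e show ?thesis by (intro exI[of _ e]) auto
qed

text \<open>\<open>diag_val x v\<close> takes the output of the \<open>x\<close>-th program on \<open>x\<close> to be the one found first, so that it
  is unique without an appeal to determinism of \<open>theorems\<close>; the class \<open>diag\<close> is that of the two-valued
  diagonally noncomputable functions.\<close>

definition diag_val :: "nat \<Rightarrow> nat \<Rightarrow> bool" where
  "diag_val x v \<longleftrightarrow> (\<exists>z. derives 0 (trip x x (pfst z)) (psnd z) \<and>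
     (\<forall>u<z. \<not> derives 0 (trip x x (pfst u)) (psnd u)) \<and> v = pfst z)"

definition diag :: "(nat \<Rightarrow> nat) set" where
  "diag = {f \<in> cantor. \<forall>x. \<not> diag_val x (f x)}"

lemma diag_val_unique: "diag_val x v \<Longrightarrow> diag_val x w \<Longrightarrow> v = w"
  unfolding diag_val_def by (metis nat_neq_iff)

lemma diag_nonempty: "diag \<noteq> {}"
proof -
  \<comment> \<open>At most one value is forbidden at each place, so 0 or 1 is free.\<close>
  have "\<not> diag_val x (if diag_val x 0 then 1 else 0)" for x
    using diag_val_unique[of x 0 1] by auto
  then have "(\<lambda>x. if diag_val x 0 then 1 else 0) \<in> diag"
    by (simp add: diag_def cantor_def)
  then show ?thesis by blast
qed

lemma pi_class_diag: "\<exists>e. pi_class e = diag"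
proof -
  have "Sigma01 {}"
    using Sigma01_search[where P="\<lambda>_ _ _. False"] dec_const by simp
  from Sigma01_iff_hit[OF this] obtain d where d: "\<And>f n. \<not> (\<exists>s. hit d n f s)"
    by blast
  \<comment> \<open>\<open>pfst s\<close> is the diagonal argument and \<open>psnd s\<close> the
    first stage at which its program gives an output.\<close>
  let ?P = "\<lambda>\<sigma> s. pfst s < length (list_decode \<sigma>) \<and>
      derives 0 (trip (pfst s) (pfst s) (pfst (psnd s))) (psnd (psnd s)) \<and>
      (\<forall>u<psnd s. \<not> derives 0 (trip (pfst s) (pfst s) (pfst u)) (psnd u)) \<and>
      nthd (list_decode \<sigma>) (pfst s) = pfst (psnd s)"
  have "dec_in {} (\<lambda>z. ?P (pfst z) (psnd z))"
    by (intro rec_intros)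
  from pi_class_avoid[where P="?P", OF this, of d] obtain e where
    e: "pi_class e = {f \<in> pi_class d. \<not> (\<exists>\<sigma> s. f \<in> cylinder (list_decode \<sigma>) \<and> ?P \<sigma> s)}"
    by blast
  have P_iff: "(\<exists>\<sigma> s. f \<in> cylinder (list_decode \<sigma>) \<and> ?P \<sigma> s) \<longleftrightarrow> (\<exists>x. diag_val x (f x))" for f
  proof
    assume "\<exists>\<sigma> s. f \<in> cylinder (list_decode \<sigma>) \<and> ?P \<sigma> s"
    then obtain \<sigma> s where s: "f \<in> cylinder (list_decode \<sigma>)" "?P \<sigma> s" by blast
    then have "f (pfst s) = pfst (psnd s)" by (auto simp: cylinder_iff)
    with s(2) have "diag_val (pfst s) (f (pfst s))" by (auto simp: diag_val_def)
    then show "\<exists>x. diag_val x (f x)" ..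
  next
    assume "\<exists>x. diag_val x (f x)"
    then obtain x z where "derives 0 (trip x x (pfst z)) (psnd z)"
        "\<forall>u<z. \<not> derives 0 (trip x x (pfst u)) (psnd u)" "f x = pfst z"
      unfolding diag_val_def by blast
    then show "\<exists>\<sigma> s. f \<in> cylinder (list_decode \<sigma>) \<and> ?P \<sigma> s"
      by (intro exI[of _ "list_encode (map f [0..<Suc x])"] exI[of _ "prod_encode (x, z)"])
        (auto simp: cylinder_iff nthd_def simp del: upt_Suc)
  qed
  have "pi_class d = cantor" using d by (simp add: pi_class_def)
  then have "pi_class e = diag" unfolding e P_iff diag_def by simp
  then show ?thesis ..
qed

text \<open>If every member of the class took the same value at every place, a program could find these
  values by exhausting the approximations; \<open>diag\<close> rules out that program at its own index.\<close>

lemma pi_class_split: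
  assumes "pi_class d \<noteq> {}" "pi_class d \<subseteq> diag"
  shows "\<exists>j. \<forall>v<2. \<exists>f\<in>pi_class d. f j = v"
proof (rule ccontr)
  assume "\<not> ?thesis"
  then have const: "\<exists>v<2. \<forall>f\<in>pi_class d. f j \<noteq> v" for j
    by auto
  \<comment> \<open>\<open>z\<close> packs a length and a value: every binary string of that length
    has this value at \<open>x\<close> unless already seen to be removed.\<close>
  define D where "D x z \<longleftrightarrow> x < pfst z \<and> (\<forall>k<2 ^ pfst z. bit_fun k x = psnd z \<or> (\<exists>s\<le>pfst z. hit d 0 (bit_fun k) s))"
    for x z
  have "dec_in {} (\<lambda>z. D (pfst z) (psnd z))"
    unfolding D_def by (intro rec_intros)
  from search_in[OF this]
  have "partial_recursive_in {} (\<lambda>x. Option.bind (if \<exists>z. D x z then Some (LEAST z. D x z) else None)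
      (\<lambda>z. Some (psnd z)))"
    by (intro partial_recursive_in.comp) (simp_all add: psnd_def partial_recursive_in.proj2)
  then obtain e where e: "\<And>x y. Option.bind (if \<exists>z. D x z then Some (LEAST z. D x z) else None)
      (\<lambda>z. Some (psnd z)) = Some y \<longleftrightarrow> (\<exists>c. derives 0 (trip e x y) c)"
    using partial_recursive_code by blast
  obtain v where v: "v < 2" "\<forall>f\<in>pi_class d. f e \<noteq> v" using const by blast
  \<comment> \<open>Members of the class have value \<open>1 - v\<close> at \<open>e\<close>, and
    all other oracles are removed at some stage. Asking \<open>e < s\<close> makes the condition
    depend on \<open>f\<close> below \<open>s\<close> only.\<close>
  have "\<exists>N. \<forall>f\<in>cantor. \<exists>s\<le>N. e < s \<and> (f e = 1 - v \<or> (\<exists>t\<le>s. hit d 0 f t))"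
  proof (rule cantor_compact)
    fix f :: "nat \<Rightarrow> nat" assume f: "f \<in> cantor"
    then have "f e < 2" by (simp add: cantor_def)
    show "\<exists>s. e < s \<and> (f e = 1 - v \<or> (\<exists>t\<le>s. hit d 0 f t))"
    proof (cases "f \<in> pi_class d")
      case True
      with v \<open>f e < 2\<close> have "f e = 1 - v" by (auto simp: less_2_cases_iff)
      then show ?thesis by blast
    next
      case False
      then obtain t where "hit d 0 f t" using f by (auto simp: pi_class_def)
      then show ?thesis by (intro exI[of _ "max (Suc e) t"]) auto
    qed
  next
    fix f g :: "nat \<Rightarrow> nat" and s assume *: "\<And>i. i < s \<Longrightarrow> f i = g i"
    then have "hit d 0 f t \<longleftrightarrow> hit d 0 g t" if "t \<le> s" for t
      using that by (intro hit_cong) simp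
    with * show "e < s \<and> (f e = 1 - v \<or> (\<exists>t\<le>s. hit d 0 f t)) \<longleftrightarrow>
        e < s \<and> (g e = 1 - v \<or> (\<exists>t\<le>s. hit d 0 g t))"
      by auto
  qed
  then obtain N where N: "\<And>f. f \<in> cantor \<Longrightarrow> \<exists>s\<le>N. e < s \<and> (f e = 1 - v \<or> (\<exists>t\<le>s. hit d 0 f t))"
    by blast
  then have "D e (prod_encode (N, 1 - v))"
    using bit_fun_cantor unfolding D_def by simp (metis le_trans less_le_trans)
  then have D_ex: "\<exists>z. D e z" ..
  define z where "z = (LEAST z. D e z)"
  have D: "D e z" unfolding z_def using D_ex by (rule LeastI_ex)
  have e_val: "(\<exists>c. derives 0 (trip e e y) c) \<longleftrightarrow> y = psnd z" for y
    using e[of e y] D_ex by (auto simp: z_def)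
  have "\<exists>u. derives 0 (trip e e (pfst u)) (psnd u)"
    using e_val[of "psnd z"] by (metis pfst_encode psnd_encode)
  then obtain u where "derives 0 (trip e e (pfst u)) (psnd u)"
      "\<forall>w<u. \<not> derives 0 (trip e e (pfst w)) (psnd w)"
    using exists_least_iff[of "\<lambda>u. derives 0 (trip e e (pfst u)) (psnd u)"] by blast
  moreover from this have "pfst u = psnd z" using e_val by blast
  ultimately have diag: "diag_val e (psnd z)" unfolding diag_val_def by metis
  \<comment> \<open>A member is never removed, so the approximation agreeing with it must carry the
    value \<open>psnd z\<close> at \<open>e\<close>, the value forbidden in
    \<open>diag\<close>.\<close>
  obtain f where f: "f \<in> pi_class d" using assms(1) by blast
  then obtain k where k: "k < 2 ^ pfst z" "\<forall>i<pfst z. bit_fun k i = f i"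
    using cantor_approx unfolding pi_class_def by blast
  then have "hit d 0 (bit_fun k) s \<longleftrightarrow> hit d 0 f s" if "s \<le> pfst z" for s
    using that by (intro hit_cong) simp
  then have "f e = psnd z"
    using D k f unfolding D_def pi_class_def by auto
  moreover have "f \<in> diag" using f assms(2) by blast
  ultimately show False using diag by (metis (mono_tags, lifting) diag_def mem_Collect_eq)
qed

section \<open>Domination forced inside a class\<close>

definition dominated_at :: "nat \<Rightarrow> (nat \<Rightarrow> nat) \<Rightarrow> bool" where
  "dominated_at e f \<longleftrightarrow> (\<forall>g. (\<forall>x y. g x = y \<longleftrightarrow> trip e x y \<in> theorems (\<lambda>x y. f x = y)) \<longrightarrow>
     (\<exists>h. rec_in {} h \<and> (\<forall>n. g n \<le> h n)))"

lemma computably_dominated_if_dominated_at: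
  assumes "\<And>e. dominated_at e f"
  shows "computably_dominated f"
  unfolding computably_dominated_def turing_le_iff_rec_in computable_iff_rec_in
proof (intro allI impI)
  fix g assume "rec_in {f} g"
  from partial_recursive_in_code[OF this[unfolded rec_in_def], of "\<lambda>x y. f x = y"]
  obtain e where e: "\<forall>x y. g x = y \<longleftrightarrow> trip e x y \<in> theorems (\<lambda>x y. f x = y)" by auto
  show "\<exists>h. rec_in {} h \<and> (\<forall>n. g n \<le> h n)"
    by (rule assms[of e, unfolded dominated_at_def, THEN spec, THEN mp, OF e])
qed

text \<open>Either some subclass forces the \<open>e\<close>-th functional to diverge at some argument, or it is total on
  the whole class and compactness bounds its values.\<close>

lemma pi_class_dominated:
  assumes "pi_class d \<noteq> {}"
  shows "\<exists>c. pi_class c \<noteq> {} \<and> pi_class c \<subseteq> pi_class d \<and> (\<forall>f\<in>pi_class c. dominated_at e f)"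
proof -
  \<comment> \<open>\<open>s\<close> packs the used part of the oracle, the output and the
    derivation, so a bound on \<open>s\<close> also bounds the output.\<close>
  define conv where "conv n f s \<longleftrightarrow> f \<in> nbhd s \<and>
      derives (pfst s) (trip e n (pfst (psnd s))) (psnd (psnd s))" for n f s
  have theorems_iff: "trip e n y \<in> theorems (\<lambda>x y. f x = y) \<longleftrightarrow> (\<exists>s. conv n f s \<and> pfst (psnd s) = y)" for n y f
    unfolding theorems_graph_iff conv_def by (metis pfst_encode psnd_encode)
  have conv_cong: "conv n f s \<longleftrightarrow> conv n g s" if "\<And>i. i < s \<Longrightarrow> f i = g i" for n f g s
    using nbhd_cong[OF that] by (simp add: conv_def)
  show ?thesis
  proof (cases "\<exists>n. \<exists>f\<in>pi_class d. \<forall>s. \<not> conv n f s")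
    case True
    then obtain n f where f: "f \<in> pi_class d" "\<And>s. \<not> conv n f s" by blast
    let ?P = "\<lambda>\<sigma> s. derives \<sigma> (trip e n (pfst s)) (psnd s)"
    have "dec_in {} (\<lambda>z. ?P (pfst z) (psnd z))" by (intro rec_intros)
    from pi_class_avoid[where P="?P", OF this, of d] obtain c where
      c: "pi_class c = {f \<in> pi_class d. \<not> (\<exists>\<sigma> s. f \<in> cylinder (list_decode \<sigma>) \<and> ?P \<sigma> s)}"
      by blast
    have P_iff: "(\<exists>\<sigma> s. f \<in> cylinder (list_decode \<sigma>) \<and> ?P \<sigma> s) \<longleftrightarrow> (\<exists>s. conv n f s)" for f
      unfolding conv_def by (metis pfst_encode psnd_encode)
    have c: "pi_class c = {f \<in> pi_class d. \<forall>s. \<not> conv n f s}" unfolding c P_iff by simp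
    have "dominated_at e f" if "f \<in> pi_class c" for f
      unfolding dominated_at_def
    proof (intro allI impI)
      fix g assume "\<forall>x y. g x = y \<longleftrightarrow> trip e x y \<in> theorems (\<lambda>x y. f x = y)"
      then have "\<exists>s. conv n f s" using theorems_iff by blast
      \<comment> \<open>Divergence at \<open>n\<close> contradicts totality, so
        \<open>dominated_at\<close> holds vacuously.\<close>
      with that show "\<exists>h. rec_in {} h \<and> (\<forall>n. g n \<le> h n)" unfolding c by blast
    qed
    with c f show ?thesis by (intro exI[of _ c]) auto
  next
    case False
    \<comment> \<open>The alternative \<open>hit d 0 f s\<close> takes care of the oracles outside
      the class, so that compactness of all of \<open>cantor\<close> applies.\<close>
    have "\<exists>h. rec_in {} h \<and> (\<forall>n. \<forall>f\<in>cantor. \<exists>s\<le>h n. hit d 0 f s \<or> conv n f s)"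
    proof (rule cantor_compact_effective)
      show "hit d 0 f s \<or> conv n f s \<longleftrightarrow> hit d 0 g s \<or> conv n g s"
        if "\<And>i. i < s \<Longrightarrow> f i = g i" for n f g s
        using hit_cong[of s f g] conv_cong[of s f g] that by simp
      show "\<exists>s. hit d 0 f s \<or> conv n f s" if "f \<in> cantor" for n f
        using False that unfolding pi_class_def by blast
      show "dec_in {} (\<lambda>z. hit d 0 (bit_fun (pfst (psnd z))) (psnd (psnd z)) \<or>
          conv (pfst z) (bit_fun (pfst (psnd z))) (psnd (psnd z)))"
        unfolding conv_def by (intro rec_intros)
    qed
    then obtain h where h: "rec_in {} h"
      and bound: "\<And>n f. f \<in> cantor \<Longrightarrow> \<exists>s\<le>h n. hit d 0 f s \<or> conv n f s"
      by blast
    have "dominated_at e f" if f: "f \<in> pi_class d" for f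
      unfolding dominated_at_def
    proof (intro allI impI exI[of _ h] conjI h)
      fix g n assume g: "\<forall>x y. g x = y \<longleftrightarrow> trip e x y \<in> theorems (\<lambda>x y. f x = y)"
      obtain s where s: "s \<le> h n" "conv n f s"
        using bound[of f n] f unfolding pi_class_def by blast
      then have "g n = pfst (psnd s)" using g theorems_iff by blast
      also have "\<dots> \<le> s" using pfst_le psnd_le order_trans by blast
      finally show "g n \<le> h n" using s(1) by simp
    qed
    with assms show ?thesis by blast
  qed
qed

section \<open>The binary tree of classes\<close>

definition fork :: "nat \<Rightarrow> nat \<Rightarrow> nat \<Rightarrow> bool \<Rightarrow> nat \<Rightarrow> bool" where
  "fork d e j b c \<longleftrightarrow> pi_class c \<noteq> {} \<and> pi_class c \<subseteq> pi_class d \<and>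
     (\<forall>f\<in>pi_class c. dominated_at e f \<and> f j = (if b then 1 else 0))"

text \<open>Fix the value at a splitting place first, then thin out each half by
  \<open>pi_class_dominated\<close>, which preserves that value. Both halves share the place
  \<open>j\<close>.\<close>

lemma fork_exists:
  assumes "pi_class d \<noteq> {}" "pi_class d \<subseteq> diag"
  shows "\<exists>j. \<forall>b. \<exists>c. fork d e j b c"
proof -
  obtain j where j: "\<And>v. v < 2 \<Longrightarrow> \<exists>f\<in>pi_class d. f j = v"
    using pi_class_split[OF assms] by blast
  have "\<exists>c. fork d e j b c" for b
  proof -
    obtain a where a: "pi_class a = {f \<in> pi_class d. f j = (if b then 1 else 0)}"
      using pi_class_restrict by blast
    with j[of "if b then 1 else 0"] have "pi_class a \<noteq> {}" by (auto split: if_splits)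
    from pi_class_dominated[OF this, of e] obtain c where
      "pi_class c \<noteq> {}" "pi_class c \<subseteq> pi_class a" "\<forall>f\<in>pi_class c. dominated_at e f"
      by blast
    then have "fork d e j b c" unfolding fork_def a by blast
    then show ?thesis ..
  qed
  then show ?thesis by blast
qed

text \<open>If the intersection were empty, compactness would give an \<open>N\<close> such that
  each oracle is removed from one of the first classes up to index \<open>N\<close>; a member of the
  class \<open>d N\<close> lies in all of these.\<close>

lemma pi_class_Inter:
  assumes "\<And>n. pi_class (d n) \<noteq> {}" "\<And>n. pi_class (d (Suc n)) \<subseteq> pi_class (d n)"
  shows "(\<Inter>n. pi_class (d n)) \<noteq> {}"
proof
  assume empty: "(\<Inter>n. pi_class (d n)) = {}"
  have "\<exists>N. \<forall>f\<in>cantor. \<exists>s\<le>N. \<exists>n\<le>s. \<exists>t\<le>s. hit (d n) 0 f t"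
  proof (rule cantor_compact)
    fix f :: "nat \<Rightarrow> nat" assume f: "f \<in> cantor"
    obtain n where "f \<notin> pi_class (d n)" using empty by blast
    then obtain t where "hit (d n) 0 f t" using f by (auto simp: pi_class_def)
    then show "\<exists>s. \<exists>n\<le>s. \<exists>t\<le>s. hit (d n) 0 f t"
      by (meson max.cobounded1 max.cobounded2)
  next
    fix f g :: "nat \<Rightarrow> nat" and s assume *: "\<And>i. i < s \<Longrightarrow> f i = g i"
    then have "hit e 0 f t \<longleftrightarrow> hit e 0 g t" if "t \<le> s" for e t
      using that by (intro hit_cong) simp
    then show "(\<exists>n\<le>s. \<exists>t\<le>s. hit (d n) 0 f t) \<longleftrightarrow> (\<exists>n\<le>s. \<exists>t\<le>s. hit (d n) 0 g t)" by blast
  qed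
  then obtain N where N: "\<And>f. f \<in> cantor \<Longrightarrow> \<exists>s\<le>N. \<exists>n\<le>s. \<exists>t\<le>s. hit (d n) 0 f t" by blast
  obtain f where f: "f \<in> pi_class (d N)" using assms(1) by blast
  then obtain n t where "n \<le> N" "hit (d n) 0 f t"
    using N[of f] order_trans unfolding pi_class_def by blast
  moreover have "pi_class (d N) \<subseteq> pi_class (d n)"
    using \<open>n \<le> N\<close> assms(2) by (rule lift_Suc_antimono_le[rotated])
  ultimately show False using f by (auto simp: pi_class_def)
qed

lemma continuum_computably_dominated:
  "\<exists>\<Phi> :: (nat \<Rightarrow> bool) \<Rightarrow> nat \<Rightarrow> nat. inj \<Phi> \<and> (\<forall>Z. computably_dominated (\<Phi> Z))"
proof -
  let ?ok = "\<lambda>d. pi_class d \<noteq> {} \<and> pi_class d \<subseteq> diag"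
  define j where "j d e = (SOME j. \<forall>b. \<exists>c. fork d e j b c)" for d e
  define c where "c d e b = (SOME c. fork d e (j d e) b c)" for d e b
  have fork: "fork d e (j d e) b (c d e b)" if "?ok d" for d e b
  proof -
    have "\<exists>j. \<forall>b. \<exists>c. fork d e j b c" using that by (intro fork_exists) auto
    then have "\<forall>b. \<exists>c. fork d e (j d e) b c" unfolding j_def by (rule someI_ex)
    then have "\<exists>c. fork d e (j d e) b c" ..
    then show ?thesis unfolding c_def by (rule someI_ex)
  qed
  obtain d0 where d0: "pi_class d0 = diag" using pi_class_diag by blast
  define D where "D Z n = rec_nat d0 (\<lambda>n d. c d n (Z n)) n" for Z n
  have D_Suc: "D Z (Suc n) = c (D Z n) n (Z n)" for Z n by (simp add: D_def)
  have ok: "?ok (D Z n)" for Z n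
  proof (induction n)
    case 0
    show ?case using d0 diag_nonempty by (simp add: D_def)
  next
    case (Suc n)
    from fork[OF this, of n "Z n"] Suc show ?case unfolding D_Suc fork_def by blast
  qed
  have dec: "pi_class (D Z (Suc n)) \<subseteq> pi_class (D Z n)" for Z n
    using fork[OF ok, of Z n n "Z n"] by (simp add: D_Suc fork_def)
  define \<Phi> where "\<Phi> Z = (SOME f. f \<in> (\<Inter>n. pi_class (D Z n)))" for Z
  have \<Phi>: "\<Phi> Z \<in> pi_class (D Z n)" for Z n
  proof -
    have "(\<Inter>n. pi_class (D Z n)) \<noteq> {}" by (rule pi_class_Inter) (use ok dec in auto)
    then have "\<Phi> Z \<in> (\<Inter>n. pi_class (D Z n))" unfolding \<Phi>_def by (rule some_in_eq[THEN iffD2])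
    then show ?thesis by blast
  qed
  have "dominated_at n (\<Phi> Z) \<and> \<Phi> Z (j (D Z n) n) = (if Z n then 1 else 0)" for n Z
    using fork[OF ok, of Z n n "Z n"] \<Phi>[of Z "Suc n"] unfolding D_Suc fork_def by blast
  note \<Phi>_fork = this
  have "computably_dominated (\<Phi> Z)" for Z
    using \<Phi>_fork by (intro computably_dominated_if_dominated_at) blast
  moreover have "inj \<Phi>"
  proof (rule injI, rule ccontr)
    fix Y Z assume eq: "\<Phi> Y = \<Phi> Z" and "Y \<noteq> Z"
    then have "\<exists>n. Y n \<noteq> Z n" by (auto simp: fun_eq_iff)
    \<comment> \<open>Up to the first difference both branches run through the same classes, so they
      split at the same place and take different values there.\<close>
    then obtain n where n: "Y n \<noteq> Z n" "\<And>m. m < n \<Longrightarrow> Y m = Z m"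
      using exists_least_iff[of "\<lambda>n. Y n \<noteq> Z n"] by blast
    have "m \<le> n \<Longrightarrow> D Y m = D Z m" for m
      using n(2) by (induction m) (simp_all add: D_def)
    then have D: "D Y n = D Z n" by simp
    with \<Phi>_fork[of n Y] \<Phi>_fork[of n Z] n(1) eq show False by (auto split: if_splits)
  qed
  ultimately show ?thesis by blast
qed

theorem theorem14:
  shows "(\<forall>A :: nat set. strongly_relativizes_Delta01 (indicator A) \<longleftrightarrow>
            computably_dominated (indicator A))
    \<and> {f :: nat \<Rightarrow> nat. strongly_relativizes_Delta01 f} \<approx> (UNIV :: real set)"
proof (intro conjI allI)
  fix A :: "nat set"
  have "indicator A \<in> cantor" by (simp add: cantor_def indicator_def)
  then show "strongly_relativizes_Delta01 (indicator A) \<longleftrightarrow> computably_dominated (indicator A)"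
    using strongly_relativizes_imp_computably_dominated computably_dominated_imp_strongly_relativizes
    by blast
next
  let ?S = "{f :: nat \<Rightarrow> nat. strongly_relativizes_Delta01 f}"
  \<comment> \<open>Upper bound: a function is determined by its coded graph, a set of
    numbers.\<close>
  have "inj (\<lambda>f :: nat \<Rightarrow> nat. range (\<lambda>n. prod_encode (n, f n)))"
  proof (intro injI ext)
    fix f g :: "nat \<Rightarrow> nat" and n
    assume "range (\<lambda>n. prod_encode (n, f n)) = range (\<lambda>n. prod_encode (n, g n))"
    then have "prod_encode (n, f n) \<in> range (\<lambda>n. prod_encode (n, g n))" by blast
    then show "f n = g n" by auto
  qed
  then have "?S \<lesssim> (UNIV :: nat set set)"
    unfolding lepoll_def by (meson inj_on_subset subset_UNIV)
  also have "(UNIV :: nat set set) \<approx> (UNIV :: real set)" by (rule nat_sets_eqpoll_reals)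
  finally have le: "?S \<lesssim> (UNIV :: real set)" .
  obtain \<Phi> :: "(nat \<Rightarrow> bool) \<Rightarrow> nat \<Rightarrow> nat" where
    \<Phi>: "inj \<Phi>" "\<And>Z. computably_dominated (\<Phi> Z)"
    using continuum_computably_dominated by blast
  \<comment> \<open>Lower bound: sets of numbers, as branches, inject into the dominated
    reals.\<close>
  have "inj (\<lambda>A n. n \<in> (A :: nat set))" by (rule injI) (simp add: fun_eq_iff set_eq_iff)
  with \<Phi>(1) have "inj (\<lambda>A. \<Phi> (\<lambda>n. n \<in> A))"
    using inj_compose[of \<Phi> "\<lambda>A n. n \<in> A"] by (simp add: comp_def)
  then have "(UNIV :: nat set set) \<lesssim> ?S"
    using \<Phi>(2) computably_dominated_imp_strongly_relativizes unfolding lepoll_def by blast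
  with eqpoll_sym[OF nat_sets_eqpoll_reals] have "(UNIV :: real set) \<lesssim> ?S"
    by (rule lepoll_trans1)
  with le show "?S \<approx> (UNIV :: real set)" by (rule lepoll_antisym)
qed

end
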